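(* Let $\widetilde{\Sigma}=\widetilde{\Sigma}_1\uplus\cdots\uplus\widetilde{\Sigma}_n$ with pairwise disjoint visibly pushdown alphabets $\widetilde{\Sigma}_i$. If $\prec$ is a visibly pushdown contextual order on $\widetilde{\Sigma}$ and $P_1\subseteq\widetilde{\Sigma}_1^*,\ldots,P_n\subseteq\widetilde{\Sigma}_n^*$ are well-matched visibly pushdown languages, then $\mathrm{red}_\prec(P_1\bowtie\cdots\bowtie P_n)$ is a visibly pushdown language.
   Context: A visibly pushdown (VP) alphabet is a finite alphabet partitioned into calls, returns and internals; $\widetilde{\Sigma}$ has as calls/returns/internals the unions. Calls and returns in a word are matched like opening and closing parentheses (internals ignored); unmatched ones are pending; a word is well-matched if none are pending. A visibly pushdown automaton (VPA) is a pushdown automaton with bottom symbol $\bot$ that pushes one non-$\bot$ symbol on each call, pops the top on each return (reading $\bot$ on empty stack without removing it), and leaves the stack unchanged on internals; visibly pushdown languages are those accepted by VPAs; deterministic = one initial state and at most one transition per configuration and letter; complete = at least one. Shuffle: $P_1\parallel\cdots\parallel P_n=\{w\in\widetilde{\Sigma}^*:\Pi_{\widetilde{\Sigma}_i}(w)\in P_i\ \forall i\}$, $\Pi_{\widetilde{\Sigma}_i}$ erasing letters outside $\widetilde{\Sigma}_i$. A word is well-nested if every matched call–return pair consists of letters from the same $\widetilde{\Sigma}_k$; $P_1\bowtie\cdots\bowtie P_n$ is the set of well-nested words of $P_1\parallel\cdots\parallel P_n$. $\mathbb{I}=\{(a,b):a\in\widetilde{\Sigma}_i,b\in\widetilde{\Sigma}_j,i\ne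 j\}$, $\equiv_{\mathbb{I}}$ the least reflexive transitive relation with $uabv\equiv_{\mathbb{I}}ubav$ for $(a,b)\in\mathbb{I}$. A contextual order is a map $\prec$ from $\widetilde{\Sigma}^*$ to strict total orders on $\widetilde{\Sigma}$; it induces $\preceq$: $\sigma\preceq\rho$ iff $\sigma$ is a prefix of $\rho$ or $\sigma=\alpha a\beta$, $\rho=\alpha b\gamma$ with $a\prec_\alpha b$. $\mathrm{red}_\prec(L)=\{w\in L:\forall u\in L,(u\equiv_{\mathbb{I}}w\wedge u\preceq w)\Rightarrow u=w\}$. $\prec$ is visibly pushdown if there is a complete deterministic VPA $A$ over $\widetilde{\Sigma}$ and a map $\mathsf{ord}$ from its states to strict total orders on $\widetilde{\Sigma}$ with $\prec_w=\mathsf{ord}(q)$, $q$ the state reached by $A$ after reading $w$. *)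

theory Defs
  imports Main "HOL-Library.Sublist"
begin

type_synonym 'a vpalph = "'a set \<times> 'a set \<times> 'a set"

definition calls :: "'a vpalph \<Rightarrow> 'a set" where "calls S = fst S"
definition rets :: "'a vpalph \<Rightarrow> 'a set" where "rets S = fst (snd S)"
definition ints :: "'a vpalph \<Rightarrow> 'a set" where "ints S = snd (snd S)"
definition letters :: "'a vpalph \<Rightarrow> 'a set" where
  "letters S = calls S \<union> rets S \<union> ints S"

definition vp_alph :: "'a vpalph \<Rightarrow> bool" where
  "vp_alph S \<longleftrightarrow> finite (letters S) \<and> calls S \<inter> rets S = {} \<and>
     calls S \<inter> ints S = {} \<and> rets S \<inter> ints S = {}"

definition union_alph :: "nat \<Rightarrow> (nat \<Rightarrow> 'a vpalph) \<Rightarrow> 'a vpalph" where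
  "union_alph n Sig = ((\<Union>i<n. calls (Sig i)), (\<Union>i<n. rets (Sig i)), (\<Union>i<n. ints (Sig i)))"

inductive well_matched :: "'a vpalph \<Rightarrow> 'a list \<Rightarrow> bool" for S where
  wm_nil: "well_matched S []"
| wm_int: "a \<in> ints S \<Longrightarrow> well_matched S [a]"
| wm_app: "well_matched S u \<Longrightarrow> well_matched S v \<Longrightarrow> well_matched S (u @ v)"
| wm_nest: "c \<in> calls S \<Longrightarrow> r \<in> rets S \<Longrightarrow> well_matched S u \<Longrightarrow> well_matched S (c # u @ [r])"

definition matched :: "'a vpalph \<Rightarrow> 'a list \<Rightarrow> nat \<Rightarrow> nat \<Rightarrow> bool" where
  "matched S w i j \<longleftrightarrow> i < j \<and> j < length w \<and> w ! i \<in> calls S \<and> w ! j \<in> rets S \<and>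
     well_matched S (take (j - i - 1) (drop (i + 1) w))"

definition well_nested :: "nat \<Rightarrow> (nat \<Rightarrow> 'a vpalph) \<Rightarrow> 'a list \<Rightarrow> bool" where
  "well_nested n Sig w \<longleftrightarrow> (\<forall>i j. matched (union_alph n Sig) w i j \<longrightarrow>
      (\<exists>k<n. w ! i \<in> letters (Sig k) \<and> w ! j \<in> letters (Sig k)))"

text \<open>Stack symbols of type 'g; the bottom symbol \<bottom> is represented by None
  in return transitions (read on the empty stack, which is not popped).\<close>
record ('s, 'g, 'a) vpa =
  states :: "'s set"
  stk :: "'g set"
  init :: "'s set"
  final :: "'s set"
  dcall :: "('s \<times> 'a \<times> 's \<times> 'g) set"
  dret :: "('s \<times> 'a \<times> 'g option \<times> 's) set"
  dint :: "('s \<times> 'a \<times> 's) set"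

definition vpa_wf :: "'a vpalph \<Rightarrow> ('s, 'g, 'a) vpa \<Rightarrow> bool" where
  "vpa_wf S A \<longleftrightarrow> finite (states A) \<and> finite (stk A) \<and> init A \<subseteq> states A \<and>
     final A \<subseteq> states A \<and>
     dcall A \<subseteq> states A \<times> calls S \<times> states A \<times> stk A \<and>
     dret A \<subseteq> states A \<times> rets S \<times> insert None (Some ` stk A) \<times> states A \<and>
     dint A \<subseteq> states A \<times> ints S \<times> states A"

definition vstep :: "('s, 'g, 'a) vpa \<Rightarrow> ('s \<times> 'g list) \<Rightarrow> 'a \<Rightarrow> ('s \<times> 'g list) \<Rightarrow> bool" where
  "vstep A c a c' \<longleftrightarrow>
     (\<exists>g. (fst c, a, fst c', g) \<in> dcall A \<and> snd c' = g # snd c) \<or>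
     (\<exists>g s. snd c = g # s \<and> (fst c, a, Some g, fst c') \<in> dret A \<and> snd c' = s) \<or>
     (snd c = [] \<and> (fst c, a, None, fst c') \<in> dret A \<and> snd c' = []) \<or>
     ((fst c, a, fst c') \<in> dint A \<and> snd c' = snd c)"

fun vrun :: "('s, 'g, 'a) vpa \<Rightarrow> ('s \<times> 'g list) \<Rightarrow> 'a list \<Rightarrow> ('s \<times> 'g list) \<Rightarrow> bool" where
  "vrun A c [] c' \<longleftrightarrow> c = c'"
| "vrun A c (a # w) c' \<longleftrightarrow> (\<exists>c''. vstep A c a c'' \<and> vrun A c'' w c')"

definition vlang :: "'a vpalph \<Rightarrow> ('s, 'g, 'a) vpa \<Rightarrow> 'a list set" where
  "vlang S A = {w. w \<in> lists (letters S) \<and>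
      (\<exists>q0\<in>init A. \<exists>q st. vrun A (q0, []) w (q, st) \<and> q \<in> final A)}"

definition vp_language :: "'a vpalph \<Rightarrow> 'a list set \<Rightarrow> bool" where
  "vp_language S L \<longleftrightarrow> (\<exists>A :: (nat, nat, 'a) vpa. vpa_wf S A \<and> vlang S A = L)"

definition det_complete :: "'a vpalph \<Rightarrow> ('s, 'g, 'a) vpa \<Rightarrow> bool" where
  "det_complete S A \<longleftrightarrow> (\<exists>q0. init A = {q0}) \<and>
     (\<forall>q\<in>states A. \<forall>a\<in>calls S. \<exists>!p. (q, a, fst p, snd p) \<in> dcall A) \<and>
     (\<forall>q\<in>states A. \<forall>a\<in>rets S. \<forall>g\<in>insert None (Some ` stk A). \<exists>!q'. (q, a, g, q') \<in> dret A) \<and>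
     (\<forall>q\<in>states A. \<forall>a\<in>ints S. \<exists>!q'. (q, a, q') \<in> dint A)"

definition contextual_order :: "'a set \<Rightarrow> ('a list \<Rightarrow> ('a \<times> 'a) set) \<Rightarrow> bool" where
  "contextual_order X prec \<longleftrightarrow>
     (\<forall>w \<in> lists X. prec w \<subseteq> X \<times> X \<and> strict_linear_order_on X (prec w))"

definition ctx_le :: "('a list \<Rightarrow> ('a \<times> 'a) set) \<Rightarrow> 'a list \<Rightarrow> 'a list \<Rightarrow> bool" where
  "ctx_le prec \<sigma> \<rho> \<longleftrightarrow> prefix \<sigma> \<rho> \<or>
     (\<exists>\<alpha> a b \<beta> \<gamma>. \<sigma> = \<alpha> @ a # \<beta> \<and> \<rho> = \<alpha> @ b # \<gamma> \<and> (a, b) \<in> prec \<alpha>)"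

definition vp_contextual_order :: "'a vpalph \<Rightarrow> ('a list \<Rightarrow> ('a \<times> 'a) set) \<Rightarrow> bool" where
  "vp_contextual_order S prec \<longleftrightarrow> contextual_order (letters S) prec \<and>
     (\<exists>(A :: (nat, nat, 'a) vpa) ord. vpa_wf S A \<and> det_complete S A \<and>
        (\<forall>w \<in> lists (letters S). \<forall>q st.
           vrun A (the_elem (init A), []) w (q, st) \<longrightarrow> prec w = ord q))"

definition shuffle :: "nat \<Rightarrow> (nat \<Rightarrow> 'a vpalph) \<Rightarrow> (nat \<Rightarrow> 'a list set) \<Rightarrow> 'a list set" where
  "shuffle n Sig P = {w. w \<in> lists (letters (union_alph n Sig)) \<and>
      (\<forall>i<n. filter (\<lambda>a. a \<in> letters (Sig i)) w \<in> P i)}"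

definition nested_shuffle :: "nat \<Rightarrow> (nat \<Rightarrow> 'a vpalph) \<Rightarrow> (nat \<Rightarrow> 'a list set) \<Rightarrow> 'a list set" where
  "nested_shuffle n Sig P = {w \<in> shuffle n Sig P. well_nested n Sig w}"

definition indep :: "nat \<Rightarrow> (nat \<Rightarrow> 'a vpalph) \<Rightarrow> ('a \<times> 'a) set" where
  "indep n Sig = {(a, b). \<exists>i<n. \<exists>j<n. i \<noteq> j \<and> a \<in> letters (Sig i) \<and> b \<in> letters (Sig j)}"

definition trace_equiv :: "('a \<times> 'a) set \<Rightarrow> ('a list \<times> 'a list) set" where
  "trace_equiv I = {(u @ a # b # v, u @ b # a # v) | u a b v. (a, b) \<in> I}\<^sup>*"

definition red :: "('a \<times> 'a) set \<Rightarrow> ('a list \<Rightarrow> ('a \<times> 'a) set) \<Rightarrow> 'a list set \<Rightarrow> 'a list set" where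
  "red I prec L = {w \<in> L. \<forall>u \<in> L. ((u, w) \<in> trace_equiv I \<and> ctx_le prec u w) \<longrightarrow> u = w}"

end

theory Submission
  imports Defs
begin

text \<open>A partial schedule of the components that is nested so far can always be completed: run
  the component of the innermost pending call until its return, and so on. Hence a word
  \<open>\<alpha> b \<gamma>\<close> of the nested shuffle fails to be minimal by a smaller letter \<open>a\<close> at
  position \<open>\<alpha>\<close> iff \<open>a\<close> is the next letter of some other component, and, if \<open>a\<close> is a return,
  the innermost pending call of \<open>\<alpha>\<close> belongs to that component. For each fixed letter \<open>a\<close> a
  VPA running the automaton of the contextual order detects this with two extra bits, so the
  reduction is a finite intersection of visibly pushdown languages.\<close>

section \<open>Closure properties of visibly pushdown languages\<close>

text \<open>Minimality quantifies over all equivalent words, and commuting letters disturbs the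
  call-return structure, so a VPA cannot simply range over the competitors. But the order depends
  only on the first difference between a competitor and the word, and completability removes the
  rest of the competitor from the condition. What remains still speaks of the future:
  \<open>a\<close> has to be the next letter of its component. This is settled by waiting: a bit
  remembers that \<open>a\<close> would have been a smaller admissible choice at some position since
  the last letter of its component, and the run dies if \<open>a\<close> is then read. Fixing
  \<open>a\<close> in advance keeps this to a single bit. Well-matchedness of the components makes
  up for acceptance by final state, which cannot test the stack: it forces the stack to be empty
  after a nested word of the shuffle.\<close>

lemma vstep_wf:
  assumes "vpa_wf S A" "vstep A (q, s) a (q', s')"
  shows "q' \<in> states A" "s \<in> lists (stk A) \<Longrightarrow> s' \<in> lists (stk A)"
  using assms unfolding vpa_wf_def vstep_def by auto

lemma vrun_append:
  "vrun A c (u @ v) c' \<longleftrightarrow> (\<exists>d. vrun A c u d \<and> vrun A d v c')"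
  by (induction u arbitrary: c) auto

lemma vrun_wf:
  assumes "vpa_wf S A" "vrun A (q, s) w (q', s')" "q \<in> states A" "s \<in> lists (stk A)"
  shows "q' \<in> states A \<and> s' \<in> lists (stk A)"
  using assms(2-4)
proof (induction w arbitrary: q s)
  case (Cons a w)
  then obtain p t where "vstep A (q, s) a (p, t)" "vrun A (p, t) w (q', s')" by auto
  then show ?case using Cons.IH Cons.prems(3) vstep_wf[OF assms(1)] by blast
qed simp

text \<open>\<open>vstep\<close> does not look at the class of the letter; well-formedness together
  with disjointness of the three classes leaves one kind of transition for each.\<close>

lemma vstep_call:
  assumes "vpa_wf S A" "vp_alph S" "a \<in> calls S"
  shows "vstep A (q, s) a (q', s') \<longleftrightarrow> (\<exists>g. (q, a, q', g) \<in> dcall A \<and> s' = g # s)"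
  using assms unfolding vpa_wf_def vstep_def vp_alph_def by auto

lemma vstep_ret:
  assumes "vpa_wf S A" "vp_alph S" "a \<in> rets S"
  shows "vstep A (q, s) a (q', s') \<longleftrightarrow> (\<exists>g. s = g # s' \<and> (q, a, Some g, q') \<in> dret A) \<or>
     (s = [] \<and> s' = [] \<and> (q, a, None, q') \<in> dret A)"
  using assms unfolding vpa_wf_def vstep_def vp_alph_def by auto

lemma vstep_int:
  assumes "vpa_wf S A" "vp_alph S" "a \<in> ints S"
  shows "vstep A (q, s) a (q', s') \<longleftrightarrow> (q, a, q') \<in> dint A \<and> s' = s"
  using assms unfolding vpa_wf_def vstep_def vp_alph_def by auto

lemma vstep_letter:
  assumes "vpa_wf S A" "vstep A c a c'"
  shows "a \<in> letters S"
  using assms unfolding vpa_wf_def vstep_def letters_def by auto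

lemma letters_cases:
  assumes "a \<in> letters S"
  obtains "a \<in> calls S" | "a \<in> rets S" | "a \<in> ints S"
  using assms unfolding letters_def by auto

section \<open>Renaming states and stack symbols by natural numbers\<close>

definition map_vpa :: "('s \<Rightarrow> 't) \<Rightarrow> ('g \<Rightarrow> 'h) \<Rightarrow> ('s, 'g, 'a) vpa \<Rightarrow> ('t, 'h, 'a) vpa" where
  "map_vpa f h A = \<lparr>states = f ` states A, stk = h ` stk A, init = f ` init A, final = f ` final A,
     dcall = {(f q, a, f q', h g) | q a q' g. (q, a, q', g) \<in> dcall A},
     dret = {(f q, a, Some (h g), f q') | q a g q'. (q, a, Some g, q') \<in> dret A} \<union>
       {(f q, a, None, f q') | q a q'. (q, a, None, q') \<in> dret A},
     dint = {(f q, a, f q') | q a q'. (q, a, q') \<in> dint A}\<rparr>"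

lemma map_vpa_wf: "vpa_wf S A \<Longrightarrow> vpa_wf S (map_vpa f h A)"
  unfolding vpa_wf_def map_vpa_def by auto

lemma vstep_map_vpa:
  "vstep A (q, s) a (q', s') \<Longrightarrow> vstep (map_vpa f h A) (f q, map h s) a (f q', map h s')"
  unfolding vstep_def map_vpa_def by auto

text \<open>The renamings are injective only on the states and stack symbols of the automaton, so
  pulling a step back requires the configuration to stay inside these sets.\<close>

lemma vstep_map_vpa_inv:
  assumes wf: "vpa_wf S A" and f: "inj_on f (states A)" and h: "inj_on h (stk A)"
    and q: "q \<in> states A" and s: "s \<in> lists (stk A)"
    and st: "vstep (map_vpa f h A) (f q, map h s) a d"
  obtains q' s' where "d = (f q', map h s')" "vstep A (q, s) a (q', s')"
proof -
  have eq: "p = q" if "f p = f q" "p \<in> states A" for p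
    using that q f by (auto dest: inj_onD)
  obtain d1 d2 where d: "d = (d1, d2)" by fastforce
  consider (c) p q' g where "(p, a, q', g) \<in> dcall A" "f p = f q" "d1 = f q'" "d2 = h g # map h s"
    | (r) p q' g where "(p, a, Some g, q') \<in> dret A" "f p = f q" "d1 = f q'" "map h s = h g # d2"
    | (e) p q' where "(p, a, None, q') \<in> dret A" "f p = f q" "d1 = f q'" "s = []" "d2 = []"
    | (i) p q' where "(p, a, q') \<in> dint A" "f p = f q" "d1 = f q'" "d2 = map h s"
    using st unfolding vstep_def map_vpa_def d by auto
  then show thesis
  proof cases
    case c
    then have "p = q" using eq wf by (auto simp: vpa_wf_def)
    with c show thesis by (intro that[of q' "g # s"]) (auto simp: d vstep_def)
  next
    case r
    then have "p = q" "g \<in> stk A" using eq wf by (auto simp: vpa_wf_def)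
    moreover obtain g' s' where "s = g' # s'" "h g' = h g" "d2 = map h s'" using r by auto
    ultimately show thesis using r s h
      by (intro that[of q' s']) (auto simp: d vstep_def dest: inj_onD)
  next
    case e
    then have "p = q" using eq wf by (auto simp: vpa_wf_def)
    with e show thesis by (intro that[of q' "[]"]) (auto simp: d vstep_def)
  next
    case i
    then have "p = q" using eq wf by (auto simp: vpa_wf_def)
    with i show thesis by (intro that[of q' s]) (auto simp: d vstep_def)
  qed
qed

lemma vrun_map_vpa:
  "vrun A (q, s) w (q', s') \<Longrightarrow> vrun (map_vpa f h A) (f q, map h s) w (f q', map h s')"
proof (induction w arbitrary: q s)
  case (Cons a w)
  then obtain p t where "vstep A (q, s) a (p, t)" "vrun A (p, t) w (q', s')" by auto
  then show ?case using Cons.IH vstep_map_vpa by fastforce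
qed simp

lemma vrun_map_vpa_inv:
  assumes wf: "vpa_wf S A" and f: "inj_on f (states A)" and h: "inj_on h (stk A)"
    and "q \<in> states A" "s \<in> lists (stk A)" "vrun (map_vpa f h A) (f q, map h s) w d"
  shows "\<exists>q' s'. d = (f q', map h s') \<and> vrun A (q, s) w (q', s')"
  using assms(4-6)
proof (induction w arbitrary: q s)
  case (Cons a w)
  then obtain e where e: "vstep (map_vpa f h A) (f q, map h s) a e" "vrun (map_vpa f h A) e w d"
    by auto
  obtain p t where pt: "e = (f p, map h t)" "vstep A (q, s) a (p, t)"
    using vstep_map_vpa_inv[OF wf f h Cons.prems(1,2) e(1)] by blast
  with Cons.IH[of p t] e(2) vstep_wf[OF wf pt(2)] Cons.prems(2) show ?case by auto
qed auto

text \<open>\<open>vp_language\<close> asks for natural numbers as states and stack symbols, while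
  the constructions below live on products; finiteness supplies an injective numbering.\<close>

lemma vp_languageI:
  assumes wf: "vpa_wf S A"
  shows "vp_language S (vlang S A)"
proof -
  have fin: "finite (states A)" "finite (stk A)" using wf by (auto simp: vpa_wf_def)
  obtain f :: "_ \<Rightarrow> nat" where f: "inj_on f (states A)"
    using finite_imp_inj_to_nat_seg[OF fin(1)] by blast
  obtain h :: "_ \<Rightarrow> nat" where h: "inj_on h (stk A)"
    using finite_imp_inj_to_nat_seg[OF fin(2)] by blast
  let ?B = "map_vpa f h A"
  have sub: "init A \<subseteq> states A" "final A \<subseteq> states A" using wf by (auto simp: vpa_wf_def)
  have "vlang S ?B = vlang S A"
  proof (intro set_eqI iffI)
    fix w assume "w \<in> vlang S ?B"
    then obtain q0 q st where w: "w \<in> lists (letters S)" "q0 \<in> init A"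
      "vrun ?B (f q0, []) w (q, st)" "q \<in> f ` final A"
      by (auto simp: vlang_def map_vpa_def)
    then have "\<exists>q' s'. (q, st) = (f q', map h s') \<and> vrun A (q0, []) w (q', s')"
      using sub by (intro vrun_map_vpa_inv[OF wf f h]) auto
    then obtain q' s' where r: "q = f q'" "vrun A (q0, []) w (q', s')" by blast
    then have "q' \<in> states A" using vrun_wf[OF wf r(2)] w sub by auto
    then have "q' \<in> final A" using w r sub f by (auto dest: inj_onD)
    with r w show "w \<in> vlang S A" by (auto simp: vlang_def)
  next
    fix w assume "w \<in> vlang S A"
    then show "w \<in> vlang S ?B"
      using vrun_map_vpa[of A _ "[]" w _ _ f h] by (fastforce simp: vlang_def map_vpa_def)
  qed
  then show ?thesis using map_vpa_wf[OF wf] unfolding vp_language_def by metis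
qed

lemma vp_language_lists:
  assumes "vp_alph S"
  shows "vp_language S (lists (letters S))"
proof -
  \<comment> \<open>The return transitions include the one on \<open>None\<close>, so pending
    returns do not block.\<close>
  let ?A = "\<lparr>states = {()}, stk = {()}, init = {()}, final = {()},
    dcall = {()} \<times> calls S \<times> {()} \<times> {()}, dret = {()} \<times> rets S \<times> UNIV \<times> {()},
    dint = {()} \<times> ints S \<times> {()}\<rparr> :: (unit, unit, 'a) vpa"
  have wf: "vpa_wf S ?A" by (auto simp: vpa_wf_def)
  have step: "\<exists>s'. vstep ?A ((), s) a ((), s')" if "a \<in> letters S" for a s
    using that by (cases s) (auto simp: vstep_def letters_def)
  have "\<exists>s'. vrun ?A ((), s) w ((), s')" if "w \<in> lists (letters S)" for w s
    using that
  proof (induction w arbitrary: s)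
    case (Cons a w)
    then show ?case using step[of a s] by auto blast
  qed simp
  then have "vlang S ?A = lists (letters S)" by (auto simp: vlang_def)
  with vp_languageI[OF wf] show ?thesis by simp
qed

section \<open>Synchronous products and finite intersections\<close>

definition prod_vpa :: "('s, 'g, 'a) vpa \<Rightarrow> ('t, 'h, 'a) vpa \<Rightarrow> ('s \<times> 't, 'g \<times> 'h, 'a) vpa" where
  "prod_vpa A B = \<lparr>states = states A \<times> states B, stk = stk A \<times> stk B,
     init = init A \<times> init B, final = final A \<times> final B,
     dcall = {((p, q), a, (p', q'), (g, h)) | p q a p' q' g h.
       (p, a, p', g) \<in> dcall A \<and> (q, a, q', h) \<in> dcall B},
     dret = {((p, q), a, Some (g, h), (p', q')) | p q a p' q' g h.
       (p, a, Some g, p') \<in> dret A \<and> (q, a, Some h, q') \<in> dret B} \<union>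
       {((p, q), a, None, (p', q')) | p q a p' q'.
       (p, a, None, p') \<in> dret A \<and> (q, a, None, q') \<in> dret B},
     dint = {((p, q), a, (p', q')) | p q a p' q'.
       (p, a, p') \<in> dint A \<and> (q, a, q') \<in> dint B}\<rparr>"

lemma prod_vpa_wf: "vpa_wf S A \<Longrightarrow> vpa_wf S B \<Longrightarrow> vpa_wf S (prod_vpa A B)"
  unfolding vpa_wf_def prod_vpa_def by auto

lemma prod_vpa_simps:
  "((p, q), a, (p', q'), (g, h)) \<in> dcall (prod_vpa A B) \<longleftrightarrow>
     (p, a, p', g) \<in> dcall A \<and> (q, a, q', h) \<in> dcall B"
  "((p, q), a, Some (g, h), (p', q')) \<in> dret (prod_vpa A B) \<longleftrightarrow>
     (p, a, Some g, p') \<in> dret A \<and> (q, a, Some h, q') \<in> dret B"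
  "((p, q), a, None, (p', q')) \<in> dret (prod_vpa A B) \<longleftrightarrow>
     (p, a, None, p') \<in> dret A \<and> (q, a, None, q') \<in> dret B"
  "((p, q), a, (p', q')) \<in> dint (prod_vpa A B) \<longleftrightarrow>
     (p, a, p') \<in> dint A \<and> (q, a, q') \<in> dint B"
  by (auto simp: prod_vpa_def)

lemma vstep_prod_vpa:
  assumes "vpa_wf S A" "vpa_wf S B" "vp_alph S"
  shows "vstep (prod_vpa A B) ((p, q), s) a ((p', q'), s') \<longleftrightarrow>
    vstep A (p, map fst s) a (p', map fst s') \<and> vstep B (q, map snd s) a (q', map snd s')"
    (is "?L = ?R")
proof (cases "a \<in> letters S")
  case False
  then show ?thesis
    using vstep_letter[OF assms(1)] vstep_letter[OF prod_vpa_wf[OF assms(1,2)]] by blast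
next
  case True
  \<comment> \<open>A stack of pairs is determined by its two projections; this recovers the
    unchanged part of the stack in each case.\<close>
  have pe: "map fst xs = map fst ys \<Longrightarrow> map snd xs = map snd ys \<Longrightarrow> xs = ys"
    for xs ys :: "('x \<times> 'y) list"
    by (metis zip_map_fst_snd)
  note wf = prod_vpa_wf[OF assms(1,2)]
  from True show ?thesis
  proof (cases rule: letters_cases)
    case 1
    show ?thesis
      unfolding vstep_call[OF wf assms(3) 1] vstep_call[OF assms(1,3) 1] vstep_call[OF assms(2,3) 1]
      using pe[of "tl s'" s] by (cases s') (auto simp: prod_vpa_simps)
  next
    case 2
    show ?thesis
      unfolding vstep_ret[OF wf assms(3) 2] vstep_ret[OF assms(1,3) 2] vstep_ret[OF assms(2,3) 2]
      using pe[of "tl s" s'] by (cases s) (auto simp: prod_vpa_simps)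
  next
    case 3
    show ?thesis
      unfolding vstep_int[OF wf assms(3) 3] vstep_int[OF assms(1,3) 3] vstep_int[OF assms(2,3) 3]
      using pe[of s' s] by (auto simp: prod_vpa_simps)
  qed
qed

text \<open>The letter alone decides between pushing, popping and keeping, so two automata reading
  the same word keep stacks of equal height. This is why a single stack of pairs can simulate
  both.\<close>

lemma vstep_length:
  assumes "vpa_wf S A" "vpa_wf S B" "vp_alph S" "length s = length t"
    "vstep A (p, s) a (p', s')" "vstep B (q, t) a (q', t')"
  shows "length s' = length t'"
proof -
  have "a \<in> letters S" using vstep_letter assms by fast
  then show ?thesis
  proof (cases rule: letters_cases)
    case 1
    then show ?thesis using assms by (auto simp: vstep_call)
  next
    case 2
    then show ?thesis using assms by (auto simp: vstep_ret)
  next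
    case 3
    then show ?thesis using assms by (auto simp: vstep_int)
  qed
qed

lemma vrun_prod_vpa:
  assumes "vpa_wf S A" "vpa_wf S B" "vp_alph S"
  shows "(\<exists>s'. vrun (prod_vpa A B) ((p, q), s) w ((p', q'), s')) \<longleftrightarrow>
    (\<exists>s'. vrun A (p, map fst s) w (p', s')) \<and> (\<exists>s'. vrun B (q, map snd s) w (q', s'))"
proof (induction w arbitrary: p q s)
  case (Cons a w)
  note step = vstep_prod_vpa[OF assms]
  show ?case (is "?L = ?R")
  proof
    assume ?L
    then obtain p1 q1 s1 s' where "vstep (prod_vpa A B) ((p, q), s) a ((p1, q1), s1)"
      "vrun (prod_vpa A B) ((p1, q1), s1) w ((p', q'), s')" by auto
    with Cons[of p1 q1 s1] step show ?R by fastforce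
  next
    assume ?R
    then obtain p1 s1 q1 s2 where 1: "vstep A (p, map fst s) a (p1, s1)"
      "vstep B (q, map snd s) a (q1, s2)"
      and 2: "\<exists>s'. vrun A (p1, s1) w (p', s')" "\<exists>s'. vrun B (q1, s2) w (q', s')"
      by (metis surj_pair vrun.simps(2))
    have "length s1 = length s2" using vstep_length[OF assms _ 1] by simp
    \<comment> \<open>Equal heights ensure that \<open>zip\<close> loses no symbol.\<close>
    then have "map fst (zip s1 s2) = s1" "map snd (zip s1 s2) = s2" by auto
    then have "vstep (prod_vpa A B) ((p, q), s) a ((p1, q1), zip s1 s2)"
      "\<exists>s'. vrun (prod_vpa A B) ((p1, q1), zip s1 s2) w ((p', q'), s')"
      using 1 2 unfolding Cons step by auto
    then show ?L by auto
  qed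
qed auto

lemma vp_language_Int:
  assumes S: "vp_alph S" and "vp_language S L" "vp_language S M"
  shows "vp_language S (L \<inter> M)"
proof -
  obtain A B :: "(nat, nat, 'a) vpa" where A: "vpa_wf S A" "vlang S A = L"
    and B: "vpa_wf S B" "vlang S B = M"
    using assms unfolding vp_language_def by blast
  have "w \<in> vlang S (prod_vpa A B) \<longleftrightarrow> w \<in> vlang S A \<and> w \<in> vlang S B" for w
  proof -
    have "w \<in> vlang S (prod_vpa A B) \<longleftrightarrow> w \<in> lists (letters S) \<and> (\<exists>p\<in>init A. \<exists>q\<in>init B.
        \<exists>p'\<in>final A. \<exists>q'\<in>final B. \<exists>s'. vrun (prod_vpa A B) ((p, q), []) w ((p', q'), s'))"
      by (fastforce simp: vlang_def prod_vpa_def)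
    also have "\<dots> \<longleftrightarrow> w \<in> vlang S A \<and> w \<in> vlang S B"
      unfolding vrun_prod_vpa[OF A(1) B(1) S] vlang_def by auto
    finally show ?thesis .
  qed
  then have "vlang S (prod_vpa A B) = L \<inter> M" using A(2) B(2) by blast
  with vp_languageI[OF prod_vpa_wf[OF A(1) B(1)]] show ?thesis by simp
qed

text \<open>Intersecting with all words over the alphabet gives the empty family a visibly pushdown
  value.\<close>

lemma vp_language_INT:
  assumes S: "vp_alph S" and "finite I" and "\<And>i. i \<in> I \<Longrightarrow> vp_language S (F i)"
  shows "vp_language S (lists (letters S) \<inter> (\<Inter>i\<in>I. F i))"
  using assms(2,3)
proof (induction I rule: finite_induct)
  case empty
  show ?case using vp_language_lists[OF S] by simp
next
  case (insert i I)
  have "lists (letters S) \<inter> (\<Inter>j\<in>insert i I. F j) =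
      F i \<inter> (lists (letters S) \<inter> (\<Inter>j\<in>I. F j))" by auto
  then show ?case using vp_language_Int[OF S] insert by (metis insertCI)
qed

section \<open>Words in which no letter is overtaken\<close>

text \<open>The innermost call comes first. As \<open>tl [] = []\<close>, a pending return leaves
  the empty stack alone, just as a VPA does at the bottom symbol.\<close>

definition pending :: "'a vpalph \<Rightarrow> 'a list \<Rightarrow> 'a list" where
  "pending S w =
     fold (\<lambda>a s. if a \<in> calls S then a # s else if a \<in> rets S then tl s else s) w []"

lemma pending_Nil [simp]: "pending S [] = []"
  by (simp add: pending_def)

lemma pending_snoc:
  "pending S (w @ [a]) = (if a \<in> calls S then a # pending S w
     else if a \<in> rets S then tl (pending S w) else pending S w)"
  by (simp add: pending_def)

definition top_in :: "'a set \<Rightarrow> 'a list \<Rightarrow> bool" where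
  "top_in K s \<longleftrightarrow> s \<noteq> [] \<and> hd s \<in> K"

text \<open>\<open>K\<close> stands for the component of \<open>a\<close>, and \<open>w\<close> for
  the word before an occurrence of \<open>a\<close>. The absence of \<open>K\<close> since \<alpha>
  means that this \<open>a\<close> was already next in its component at \<alpha>, where it is
  smaller than \<open>b\<close>.\<close>

definition overtaken ::
  "'a vpalph \<Rightarrow> 'a set \<Rightarrow> ('a list \<Rightarrow> ('a \<times> 'a) set) \<Rightarrow> 'a \<Rightarrow> 'a list \<Rightarrow> bool" where
  "overtaken S K prec a w \<longleftrightarrow> (\<exists>\<alpha> b \<beta>. w = \<alpha> @ b # \<beta> \<and> set (b # \<beta>) \<inter> K = {} \<and>
     (a, b) \<in> prec \<alpha> \<and> (a \<in> rets S \<longrightarrow> top_in K (pending S \<alpha>)))"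

lemma overtaken_Nil [simp]: "\<not> overtaken S K prec a []"
  by (simp add: overtaken_def)

text \<open>This recursion is why one bit suffices: a letter of \<open>K\<close> clears it, any
  other letter keeps it or sets it, and only the order and the pending calls before that letter are
  consulted.\<close>

lemma overtaken_snoc:
  "overtaken S K prec a (w @ [x]) \<longleftrightarrow> x \<notin> K \<and>
     (overtaken S K prec a w \<or> (a, x) \<in> prec w \<and> (a \<in> rets S \<longrightarrow> top_in K (pending S w)))"
  (is "?L \<longleftrightarrow> ?R")
proof
  assume ?L
  then obtain \<alpha> b \<beta> where 1: "w @ [x] = \<alpha> @ b # \<beta>" "set (b # \<beta>) \<inter> K = {}"
     "(a, b) \<in> prec \<alpha>" "a \<in> rets S \<longrightarrow> top_in K (pending S \<alpha>)"
    unfolding overtaken_def by blast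
  show ?R
  proof (cases \<beta> rule: rev_cases)
    case Nil
    then show ?thesis using 1 by auto
  next
    case (snoc \<gamma> y)
    then have "overtaken S K prec a w" using 1 unfolding overtaken_def
      by (intro exI[of _ \<alpha>] exI[of _ b] exI[of _ \<gamma>]) auto
    then show ?thesis using snoc 1 by auto
  qed
next
  assume R: ?R
  show ?L
  proof (cases "overtaken S K prec a w")
    case True
    then obtain \<alpha> b \<beta> where 1: "w = \<alpha> @ b # \<beta>" "set (b # \<beta>) \<inter> K = {}"
       "(a, b) \<in> prec \<alpha>" "a \<in> rets S \<longrightarrow> top_in K (pending S \<alpha>)"
      unfolding overtaken_def by blast
    then show ?thesis using R unfolding overtaken_def
      by (intro exI[of _ \<alpha>] exI[of _ b] exI[of _ "\<beta> @ [x]"]) auto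
  next
    case False
    then show ?thesis using R unfolding overtaken_def
      by (intro exI[of _ w] exI[of _ x] exI[of _ "[]"]) auto
  qed
qed

definition overtaking_free ::
  "'a vpalph \<Rightarrow> 'a set \<Rightarrow> ('a list \<Rightarrow> ('a \<times> 'a) set) \<Rightarrow> 'a \<Rightarrow> 'a list \<Rightarrow> bool" where
  "overtaking_free S K prec a w \<longleftrightarrow> (\<forall>u v. w = u @ a # v \<longrightarrow> \<not> overtaken S K prec a u)"

lemma overtaking_free_Nil [simp]: "overtaking_free S K prec a []"
  by (simp add: overtaking_free_def)

lemma overtaking_free_snoc:
  "overtaking_free S K prec a (w @ [x]) \<longleftrightarrow>
     overtaking_free S K prec a w \<and> \<not> (x = a \<and> overtaken S K prec a w)"
  (is "?L \<longleftrightarrow> ?R")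
proof
  assume L: ?L
  have "overtaking_free S K prec a w"
    unfolding overtaking_free_def
  proof (intro allI impI)
    fix u v assume "w = u @ a # v"
    then have "w @ [x] = u @ a # (v @ [x])" by simp
    with L show "\<not> overtaken S K prec a u" unfolding overtaking_free_def by blast
  qed
  with L show ?R unfolding overtaking_free_def by simp
next
  assume R: ?R
  show ?L
    unfolding overtaking_free_def
  proof (intro allI impI)
    fix u v assume "w @ [x] = u @ a # v"
    with R show "\<not> overtaken S K prec a u"
      by (cases v rule: rev_cases) (auto simp: overtaking_free_def)
  qed
qed

text \<open>The shape of the stack invariant of \<open>overtaking_vpa\<close>: the head is the bit
  in the state, the tail the bits saved on the stack. The closing \<open>False\<close> is the bit
  that the outermost pending call saves.\<close>

fun tops :: "'a set \<Rightarrow> 'a list \<Rightarrow> bool list" where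
  "tops K [] = [False]"
| "tops K (c # s) = (c \<in> K) # tops K s"

lemma tops_not_Nil [simp]: "tops K s \<noteq> []"
  by (cases s) auto

lemma tops_eq_Cons: "tops K s = t # r \<Longrightarrow> t \<longleftrightarrow> top_in K s"
  by (cases s) (auto simp: top_in_def)

text \<open>The first conjunct blocks the run on an overtaken \<open>a\<close>, the second is the
  update of \<open>overtaken_snoc\<close>. Both take \<open>q\<close>, \<open>t\<close> and
  \<open>f\<close> from before \<open>x\<close>, since the order and the pending calls are those of
  the prefix.\<close>

definition flag_ok ::
  "'a vpalph \<Rightarrow> 'a set \<Rightarrow> ('s \<Rightarrow> ('a \<times> 'a) set) \<Rightarrow> 'a \<Rightarrow> 's \<Rightarrow> bool \<Rightarrow> bool \<Rightarrow> 'a \<Rightarrow> bool \<Rightarrow> bool" where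
  "flag_ok S K ord a q t f x f' \<longleftrightarrow> \<not> (x = a \<and> f) \<and>
     (f' \<longleftrightarrow> x \<notin> K \<and> (f \<or> (a, x) \<in> ord q \<and> (a \<in> rets S \<longrightarrow> t)))"

text \<open>In a state \<open>(q, t, f)\<close>, \<open>t\<close> records whether the innermost pending call lies in \<open>K\<close>
  (its previous value is saved on the stack by every call) and \<open>f\<close> whether \<open>a\<close> is overtaken.\<close>
definition overtaking_vpa :: "'a vpalph \<Rightarrow> 'a set \<Rightarrow> ('s \<Rightarrow> ('a \<times> 'a) set) \<Rightarrow> 'a \<Rightarrow>
    ('s, 'g, 'a) vpa \<Rightarrow> ('s \<times> bool \<times> bool, 'g \<times> bool, 'a) vpa" where
  "overtaking_vpa S K ord a B = \<lparr>states = states B \<times> UNIV, stk = stk B \<times> UNIV,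
     init = init B \<times> {(False, False)}, final = states B \<times> UNIV,
     dcall = {((q, t, f), x, (q', x \<in> K, f'), (g, t)) | q t f x q' f' g.
       (q, x, q', g) \<in> dcall B \<and> flag_ok S K ord a q t f x f'},
     dret = {((q, t, f), x, Some (g, t'), (q', t', f')) | q t f x g t' q' f'.
       (q, x, Some g, q') \<in> dret B \<and> flag_ok S K ord a q t f x f'} \<union>
       {((q, t, f), x, None, (q', t, f')) | q t f x q' f'.
       (q, x, None, q') \<in> dret B \<and> flag_ok S K ord a q t f x f'},
     dint = {((q, t, f), x, (q', t, f')) | q t f x q' f'.
       (q, x, q') \<in> dint B \<and> flag_ok S K ord a q t f x f'}\<rparr>"

lemma overtaking_vpa_wf: "vpa_wf S B \<Longrightarrow> vpa_wf S (overtaking_vpa S K ord a B)"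
  unfolding vpa_wf_def overtaking_vpa_def by (auto simp: finite_Prod_UNIV)

lemma vstep_overtaking_vpa:
  assumes B: "vpa_wf S B" and S: "vp_alph S"
    and step: "vstep (overtaking_vpa S K ord a B) ((q, t, f), st) x ((q', t', f'), st')"
  shows "vstep B (q, map fst st) x (q', map fst st')" "flag_ok S K ord a q t f x f'"
    and "tops K (pending S w) = t # map snd st \<Longrightarrow>
      tops K (pending S (w @ [x])) = t' # map snd st'"
proof -
  note wf = overtaking_vpa_wf[OF B, of K ord a]
  have "x \<in> letters S" using vstep_letter[OF wf step] .
  then have "vstep B (q, map fst st) x (q', map fst st') \<and> flag_ok S K ord a q t f x f' \<and>
    (tops K (pending S w) = t # map snd st \<longrightarrow>
      tops K (pending S (w @ [x])) = t' # map snd st')"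
  proof (cases rule: letters_cases)
    case 1
    then show ?thesis
      using step unfolding vstep_call[OF wf S 1] vstep_call[OF B S 1] pending_snoc
      by (auto simp: overtaking_vpa_def)
  next
    case 2
    then have "x \<notin> calls S" using S by (auto simp: vp_alph_def)
    with 2 show ?thesis
      using step unfolding vstep_ret[OF wf S 2] vstep_ret[OF B S 2] pending_snoc
      by (cases "pending S w") (auto simp: overtaking_vpa_def)
  next
    case 3
    then have "x \<notin> calls S" "x \<notin> rets S" using S by (auto simp: vp_alph_def)
    with 3 show ?thesis
      using step unfolding vstep_int[OF wf S 3] vstep_int[OF B S 3] pending_snoc
      by (auto simp: overtaking_vpa_def)
  qed
  then show "vstep B (q, map fst st) x (q', map fst st')" "flag_ok S K ord a q t f x f'"
    "tops K (pending S w) = t # map snd st \<Longrightarrow>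
      tops K (pending S (w @ [x])) = t' # map snd st'"
    by auto
qed

text \<open>The order is known only through the state of \<open>B\<close>, so the invariant carries
  the run of \<open>B\<close> along. All notions involved are functions of the prefix read, hence
  induction from the right.\<close>

lemma vrun_overtaking_vpa:
  assumes B: "vpa_wf S B" and S: "vp_alph S"
    and ord: "\<forall>w\<in>lists (letters S). \<forall>q st. vrun B (q0, []) w (q, st) \<longrightarrow> prec w = ord q"
    and "w \<in> lists (letters S)"
    and "vrun (overtaking_vpa S K ord a B) ((q0, False, False), []) w ((q, t, f), st)"
  shows "vrun B (q0, []) w (q, map fst st) \<and> tops K (pending S w) = t # map snd st \<and>
    (f \<longleftrightarrow> overtaken S K prec a w) \<and> overtaking_free S K prec a w"
  using assms(4,5)
proof (induction w arbitrary: q t f st rule: rev_induct)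
  case Nil
  then show ?case by auto
next
  case (snoc x w)
  then obtain p u g r where
    1: "vrun (overtaking_vpa S K ord a B) ((q0, False, False), []) w ((p, u, g), r)"
    and 2: "vstep (overtaking_vpa S K ord a B) ((p, u, g), r) x ((q, t, f), st)"
    by (auto simp: vrun_append)
  note IH = snoc.IH[OF _ 1]
  note step = vstep_overtaking_vpa[OF B S 2]
  have "prec w = ord p" using IH ord snoc.prems by auto
  moreover have "u \<longleftrightarrow> top_in K (pending S w)" using IH snoc.prems by (auto dest: tops_eq_Cons)
  ultimately show ?case
    using IH step(1,2) step(3)[of w] snoc.prems
    by (auto simp: vrun_append overtaken_snoc overtaking_free_snoc flag_ok_def)
qed

lemma det_complete_step:
  assumes B: "vpa_wf S B" and det: "det_complete S B" and q: "q \<in> states B"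
    and s: "s \<in> lists (stk B)" and x: "x \<in> letters S"
  shows "\<exists>q' s'. vstep B (q, s) x (q', s')"
  using x
proof (cases rule: letters_cases)
  case 1
  then obtain p where "(q, x, fst p, snd p) \<in> dcall B"
    using det q unfolding det_complete_def by blast
  then have "vstep B (q, s) x (fst p, snd p # s)" by (simp add: vstep_def)
  then show ?thesis by blast
next
  case 2
  then have *: "\<exists>q'. (q, x, g, q') \<in> dret B" if "g \<in> insert None (Some ` stk B)" for g
    using det q that unfolding det_complete_def by blast
  show ?thesis using *[of None] *[of "Some (hd s)"] s by (cases s) (auto simp: vstep_def)
next
  case 3
  then obtain q' where "(q, x, q') \<in> dint B"
    using det q unfolding det_complete_def by blast
  then show ?thesis by (auto simp: vstep_def)
qed

text \<open>\<open>B\<close> never blocks by completeness, and the saved bit of a popped symbol may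
  have either value, so an overtaken \<open>a\<close> is the only obstacle to a step.\<close>

lemma overtaking_vpa_step_exists:
  assumes B: "vpa_wf S B" and det: "det_complete S B" and q: "q \<in> states B"
    and s: "map fst st \<in> lists (stk B)" and x: "x \<in> letters S" and f: "\<not> (x = a \<and> f)"
  shows "\<exists>c. vstep (overtaking_vpa S K ord a B) ((q, t, f), st) x c"
proof -
  obtain q' s' where *: "vstep B (q, map fst st) x (q', s')"
    using det_complete_step[OF B det q s x] by blast
  obtain f' where f': "flag_ok S K ord a q t f x f'" using f unfolding flag_ok_def by blast
  have mem: "(q, x, q', g) \<in> dcall B \<Longrightarrow>
       ((q, t, f), x, (q', x \<in> K, f'), (g, t)) \<in> dcall (overtaking_vpa S K ord a B)"
    "(q, x, Some g, q') \<in> dret B \<Longrightarrow>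
       ((q, t, f), x, Some (g, t'), (q', t', f')) \<in> dret (overtaking_vpa S K ord a B)"
    "(q, x, None, q') \<in> dret B \<Longrightarrow>
       ((q, t, f), x, None, (q', t, f')) \<in> dret (overtaking_vpa S K ord a B)"
    "(q, x, q') \<in> dint B \<Longrightarrow>
       ((q, t, f), x, (q', t, f')) \<in> dint (overtaking_vpa S K ord a B)" for g t'
    using f' by (auto simp: overtaking_vpa_def)
  consider (call) g where "(q, x, q', g) \<in> dcall B"
    | (ret) g t' st' where "st = (g, t') # st'" "(q, x, Some g, q') \<in> dret B"
    | (empty) "st = []" "(q, x, None, q') \<in> dret B"
    | (int) "(q, x, q') \<in> dint B"
    using * unfolding vstep_def by auto
  then show ?thesis
  proof cases
    case call
    then have "vstep (overtaking_vpa S K ord a B) ((q, t, f), st) x ((q', x \<in> K, f'), (g, t) # st)"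
      using mem(1) by (auto simp: vstep_def)
    then show ?thesis by blast
  next
    case ret
    then have "vstep (overtaking_vpa S K ord a B) ((q, t, f), st) x ((q', t', f'), st')"
      using mem(2) by (auto simp: vstep_def)
    then show ?thesis by blast
  next
    case empty
    then have "vstep (overtaking_vpa S K ord a B) ((q, t, f), st) x ((q', t, f'), [])"
      using mem(3) by (auto simp: vstep_def)
    then show ?thesis by blast
  next
    case int
    then have "vstep (overtaking_vpa S K ord a B) ((q, t, f), st) x ((q', t, f'), st)"
      using mem(4) by (auto simp: vstep_def)
    then show ?thesis by blast
  qed
qed

text \<open>A violation kills the run instead of being recorded; therefore all states are final and
  acceptance amounts to having a run.\<close>

lemma vp_language_overtaking_free:
  assumes S: "vp_alph S" and prec: "vp_contextual_order S prec"
  shows "vp_language S {w \<in> lists (letters S). overtaking_free S K prec a w}"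
proof -
  obtain B :: "(nat, nat, 'a) vpa" and ord where B: "vpa_wf S B" and det: "det_complete S B"
    and o: "\<forall>w \<in> lists (letters S). \<forall>q st.
           vrun B (the_elem (init B), []) w (q, st) \<longrightarrow> prec w = ord q"
    using prec unfolding vp_contextual_order_def by blast
  obtain q0 where q0: "init B = {q0}" using det unfolding det_complete_def by blast
  with o have ord:
    "\<forall>w\<in>lists (letters S). \<forall>q st. vrun B (q0, []) w (q, st) \<longrightarrow> prec w = ord q"
    by simp
  have q0s: "q0 \<in> states B" using B q0 by (auto simp: vpa_wf_def)
  let ?R = "overtaking_vpa S K ord a B"
  note run = vrun_overtaking_vpa[OF B S ord]
  have ex: "\<exists>c. vrun ?R ((q0, False, False), []) w c"
    if "w \<in> lists (letters S)" "overtaking_free S K prec a w" for w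
    using that
  proof (induction w rule: rev_induct)
    case Nil
    then show ?case by auto
  next
    case (snoc x w)
    then obtain q t f st where 1: "vrun ?R ((q0, False, False), []) w ((q, t, f), st)"
      by (auto simp: overtaking_free_snoc)
    have w: "w \<in> lists (letters S)" "x \<in> letters S" using snoc.prems by auto
    note inv = run[OF w(1) 1]
    have "q \<in> states B \<and> map fst st \<in> lists (stk B)"
      using vrun_wf[OF B conjunct1[OF inv] q0s] by simp
    moreover have "\<not> (x = a \<and> f)" using inv snoc.prems by (auto simp: overtaking_free_snoc)
    ultimately obtain c where "vstep ?R ((q, t, f), st) x c"
      using overtaking_vpa_step_exists[OF B det _ _ w(2)] by blast
    with 1 show ?case unfolding vrun_append vrun.simps by blast
  qed
  have "vlang S ?R = {w \<in> lists (letters S). overtaking_free S K prec a w}"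
  proof (intro set_eqI iffI)
    fix w assume "w \<in> vlang S ?R"
    moreover have "init ?R = {(q0, False, False)}" using q0 by (simp add: overtaking_vpa_def)
    ultimately obtain q t f st where w: "w \<in> lists (letters S)"
      and 1: "vrun ?R ((q0, False, False), []) w ((q, t, f), st)"
      unfolding vlang_def by auto
    then show "w \<in> {w \<in> lists (letters S). overtaking_free S K prec a w}"
      using run[OF w 1] by simp
  next
    fix w assume "w \<in> {w \<in> lists (letters S). overtaking_free S K prec a w}"
    then have w: "w \<in> lists (letters S)" "overtaking_free S K prec a w" by auto
    then obtain q t f st where 1: "vrun ?R ((q0, False, False), []) w ((q, t, f), st)"
      using ex by (metis surj_pair)
    then have "q \<in> states B" using vrun_wf[OF B conjunct1[OF run[OF w(1) 1]] q0s] by simp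
    then have fin: "(q, t, f) \<in> final ?R" and "(q0, False, False) \<in> init ?R"
      using q0 by (auto simp: overtaking_vpa_def)
    then show "w \<in> vlang S ?R" using w(1) 1 unfolding vlang_def by blast
  qed
  with vp_languageI[OF overtaking_vpa_wf[OF B]] show ?thesis by metis
qed

section \<open>Nested shuffles\<close>

locale vp_family =
  fixes n :: nat and Sig :: "nat \<Rightarrow> 'a vpalph"
  assumes alph: "i < n \<Longrightarrow> vp_alph (Sig i)"
    and disj: "i < n \<Longrightarrow> j < n \<Longrightarrow> i \<noteq> j \<Longrightarrow> letters (Sig i) \<inter> letters (Sig j) = {}"
begin

abbreviation U :: "'a vpalph" where "U \<equiv> union_alph n Sig"

abbreviation K :: "nat \<Rightarrow> 'a set" where "K i \<equiv> letters (Sig i)"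

abbreviation proj :: "nat \<Rightarrow> 'a list \<Rightarrow> 'a list" where "proj i \<equiv> filter (\<lambda>a. a \<in> K i)"

definition same :: "'a \<Rightarrow> 'a \<Rightarrow> bool" where
  "same c r \<longleftrightarrow> (\<exists>k<n. c \<in> K k \<and> r \<in> K k)"

lemma union_sets:
  "calls U = (\<Union>i<n. calls (Sig i))" "rets U = (\<Union>i<n. rets (Sig i))"
  "ints U = (\<Union>i<n. ints (Sig i))" "letters U = (\<Union>i<n. K i)"
  by (auto simp: union_alph_def calls_def rets_def ints_def letters_def)

lemma K_unique: "i < n \<Longrightarrow> j < n \<Longrightarrow> a \<in> K i \<Longrightarrow> a \<in> K j \<longleftrightarrow> i = j"
  using disj by blast

lemma same_iff: "i < n \<Longrightarrow> r \<in> K i \<Longrightarrow> same c r \<longleftrightarrow> c \<in> K i"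
  "i < n \<Longrightarrow> c \<in> K i \<Longrightarrow> same c r \<longleftrightarrow> r \<in> K i"
  using K_unique unfolding same_def by blast+

lemma component_sets:
  assumes "i < n" "a \<in> K i"
  shows "a \<in> calls U \<longleftrightarrow> a \<in> calls (Sig i)" "a \<in> rets U \<longleftrightarrow> a \<in> rets (Sig i)"
    "a \<in> ints U \<longleftrightarrow> a \<in> ints (Sig i)"
proof -
  have "X (Sig j) \<subseteq> K j \<Longrightarrow> a \<in> X (Sig j) \<Longrightarrow> j < n \<Longrightarrow> j = i" for X j
    using K_unique assms by blast
  then show "a \<in> calls U \<longleftrightarrow> a \<in> calls (Sig i)" "a \<in> rets U \<longleftrightarrow> a \<in> rets (Sig i)"
    "a \<in> ints U \<longleftrightarrow> a \<in> ints (Sig i)"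
    using assms K_unique unfolding union_sets letters_def by blast+
qed

lemma vp_alph_U: "vp_alph U"
proof -
  have "finite (letters U)" using alph by (auto simp: union_sets vp_alph_def)
  moreover have "a \<notin> rets U \<and> a \<notin> ints U" if a: "a \<in> calls U" for a
  proof -
    obtain i where i: "i < n" "a \<in> calls (Sig i)" using a by (auto simp: union_sets)
    then have "a \<in> K i" by (auto simp: letters_def)
    then show ?thesis using component_sets[OF i(1)] alph[OF i(1)] i(2) by (auto simp: vp_alph_def)
  qed
  moreover have "a \<notin> ints U" if a: "a \<in> rets U" for a
  proof -
    obtain i where i: "i < n" "a \<in> rets (Sig i)" using a by (auto simp: union_sets)
    then have "a \<in> K i" by (auto simp: letters_def)
    then show ?thesis using component_sets[OF i(1)] alph[OF i(1)] i(2) by (auto simp: vp_alph_def)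
  qed
  ultimately show ?thesis by (auto simp: vp_alph_def)
qed

lemma U_disj: "a \<in> rets U \<Longrightarrow> a \<notin> calls U" "a \<in> ints U \<Longrightarrow> a \<notin> calls U"
  "a \<in> ints U \<Longrightarrow> a \<notin> rets U"
  using vp_alph_U by (auto simp: vp_alph_def)

text \<open>The stack of pending calls after a word, or \<open>None\<close> if some return is pending or
  matches a call of another component.\<close>
fun nest :: "'a list \<Rightarrow> 'a list \<Rightarrow> 'a list option" where
  "nest s [] = Some s"
| "nest s (a # w) = (if a \<in> calls U then nest (a # s) w
     else if a \<in> rets U then
       (case s of [] \<Rightarrow> None | c # s' \<Rightarrow> if same c a then nest s' w else None)
     else nest s w)"

lemma nest_append: "nest s (u @ v) = Option.bind (nest s u) (\<lambda>s'. nest s' v)"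
  by (induction u arbitrary: s) (auto split: list.splits)

lemma nest_Cons: "nest s (a # w) = Option.bind (nest s [a]) (\<lambda>s'. nest s' w)"
  using nest_append[of s "[a]" w] by simp

text \<open>Links the partial stack used in the combinatorics to the total one tracked by the
  automaton.\<close>

lemma nest_pending: "nest [] w = Some s \<Longrightarrow> pending U w = s"
proof (induction w arbitrary: s rule: rev_induct)
  case (snoc a w)
  then show ?case
    by (cases "nest [] w") (auto simp: nest_append pending_snoc split: if_splits list.splits)
qed simp

lemma nest_set: "nest s w = Some s' \<Longrightarrow> set s' \<subseteq> set s \<union> calls U"
  by (induction w arbitrary: s) (fastforce split: if_splits list.splits)+

text \<open>In a nested word a return of component \<open>i\<close> pops a call of \<open>i\<close>
  and a foreign return pops a foreign call, so erasing foreign letters erases exactly the foreign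
  stack entries.\<close>

lemma nest_proj:
  assumes i: "i < n"
  shows "nest s w = Some s' \<Longrightarrow> nest (proj i s) (proj i w) = Some (proj i s')"
proof (induction w arbitrary: s)
  case (Cons a w)
  show ?case
    using Cons.prems Cons.IH[of "a # s"] Cons.IH[of s] Cons.IH[of "tl s"] same_iff[OF i]
    by (cases "a \<in> K i") (auto split: if_splits list.splits)
qed simp

lemma nest_well_matched:
  assumes i: "i < n"
  shows "well_matched (Sig i) w \<Longrightarrow> nest s w = Some s"
proof (induction arbitrary: s rule: well_matched.induct)
  case (wm_int a)
  then have "a \<in> ints U" using i by (auto simp: union_sets)
  then show ?case using U_disj by simp
next
  case (wm_nest c r u)
  then have "c \<in> calls U" "r \<in> rets U" "c \<in> K i" "r \<in> K i"
    using i by (auto simp: union_sets letters_def)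
  then show ?case using wm_nest.IH U_disj same_iff[OF i] by (simp add: nest_append)
qed (auto simp: nest_append)

text \<open>A factor that is well-matched over the union alphabet may pair letters of different
  components, and then \<open>nest\<close> fails. Hence success of \<open>nest\<close> is a
  hypothesis here, unlike in \<open>nest_well_matched\<close>.\<close>

lemma well_matched_nest_eq:
  "well_matched U u \<Longrightarrow> nest s u = Some s' \<Longrightarrow> s' = s"
proof (induction arbitrary: s s' rule: well_matched.induct)
  case (wm_int a)
  then show ?case using U_disj by (auto split: if_splits)
next
  case (wm_app u v)
  then show ?case by (cases "nest s u") (auto simp: nest_append)
next
  case (wm_nest c r u)
  then obtain t where t: "nest (c # s) u = Some t" "nest t [r] = Some s'"
    by (cases "nest (c # s) u") (auto simp: nest_append)
  with wm_nest.IH have "t = c # s" by blast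
  with t(2) wm_nest.hyps U_disj show ?case by (auto split: if_splits)
qed simp

text \<open>Locates the call on top of the stack. If the last letter is a return, the call
  \<open>d\<close> popped by it is located first and then \<open>c\<close> in the prefix before
  \<open>d\<close>; these two uses at different lengths call for induction on the length.\<close>

lemma nest_decompose:
  assumes "set w \<subseteq> letters U" "nest [] w = Some (c # s)"
  shows "\<exists>v u. w = v @ c # u \<and> well_matched U u \<and> nest [] v = Some s"
  using assms
proof (induction w arbitrary: c s rule: length_induct)
  case (1 w)
  obtain v a where w: "w = v @ [a]" using 1(3) by (cases w rule: rev_cases) auto
  then obtain t where t: "nest [] v = Some t" "nest t [a] = Some (c # s)"
    using 1(3) by (cases "nest [] v") (auto simp: nest_append)
  have v: "set v \<subseteq> letters U" "a \<in> letters U" using 1(2) w by auto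
  from v(2) show ?case
  proof (cases rule: letters_cases)
    case 1
    with t w have "w = v @ c # []" "nest [] v = Some s" by auto
    then show ?thesis using wm_nil by blast
  next
    case 2
    then obtain d where d: "t = d # c # s" using t U_disj by (auto split: if_splits list.splits)
    then obtain v1 u1 where 3: "v = v1 @ d # u1" "well_matched U u1" "nest [] v1 = Some (c # s)"
      using "1.IH"[rule_format, of v d "c # s"] w v t by auto
    then obtain v2 u2 where 4: "v1 = v2 @ c # u2" "well_matched U u2" "nest [] v2 = Some s"
      using "1.IH"[rule_format, of v1 c s] w v by auto
    have "d \<in> calls U" using nest_set[OF t(1)] d by auto
    then have "well_matched U (u2 @ (d # u1 @ [a]))" using 2 3 4 by (intro wm_app wm_nest)
    moreover have "w = v2 @ c # (u2 @ (d # u1 @ [a]))" using w 3 4 by simp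
    ultimately show ?thesis using 4 by blast
  next
    case 3
    then have "t = c # s" using t U_disj by (auto split: if_splits)
    then obtain v1 u1 where 4: "v = v1 @ c # u1" "well_matched U u1" "nest [] v1 = Some s"
      using "1.IH"[rule_format, of v c s] w v t by auto
    then have "well_matched U (u1 @ [a])" "w = v1 @ c # (u1 @ [a])"
      using 3 w by (auto intro: wm_app wm_int)
    with 4 show ?thesis by blast
  qed
qed

text \<open>Trades positions for factorisations, along which \<open>nest\<close> can be
  followed.\<close>

lemma matched_iff:
  "matched S w i j \<longleftrightarrow> (\<exists>v c u r x. w = v @ c # u @ r # x \<and> i = length v \<and>
     j = length v + length u + 1 \<and> c \<in> calls S \<and> r \<in> rets S \<and> well_matched S u)"
  (is "?L \<longleftrightarrow> ?R")
proof
  assume L: ?L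
  define v u x where "v = take i w" "u = take (j - i - 1) (drop (i + 1) w)" "x = drop (j + 1) w"
  have ij: "i < j" "j < length w" using L by (auto simp: matched_def)
  have "w = v @ w ! i # drop (i + 1) w" using ij id_take_nth_drop[of i w] by (simp add: v_u_x_def)
  moreover have "drop (i + 1) w = u @ drop (j - i - 1) (drop (i + 1) w)"
    unfolding v_u_x_def by (rule append_take_drop_id[symmetric])
  moreover have "drop (j - i - 1) (drop (i + 1) w) = drop j w" using ij by simp
  moreover have "drop j w = w ! j # x" using ij by (simp add: v_u_x_def Cons_nth_drop_Suc)
  ultimately have "w = v @ w ! i # u @ w ! j # x" by metis
  moreover have "length v = i" "length u = j - i - 1" using ij by (auto simp: v_u_x_def)
  ultimately show ?R using L ij
    by (intro exI[of _ v] exI[of _ "w ! i"] exI[of _ u] exI[of _ "w ! j"] exI[of _ x])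
      (auto simp: matched_def v_u_x_def)
next
  assume ?R
  then show ?L by (auto simp: matched_def nth_append)
qed

lemma well_nested_iff:
  "well_nested n Sig w \<longleftrightarrow> (\<forall>v c u r x. w = v @ c # u @ r # x \<longrightarrow> c \<in> calls U \<longrightarrow>
     r \<in> rets U \<longrightarrow> well_matched U u \<longrightarrow> same c r)"
  (is "?L \<longleftrightarrow> ?R")
proof
  assume L: ?L
  show ?R
  proof (intro allI impI)
    fix v c u r x
    assume w: "w = v @ c # u @ r # x" and "c \<in> calls U" "r \<in> rets U" "well_matched U u"
    then have "matched U w (length v) (length v + length u + 1)"
      unfolding matched_iff by blast
    moreover have "w ! length v = c" "w ! (length v + length u + 1) = r"
      using w by (auto simp: nth_append)
    ultimately show "same c r" using L unfolding well_nested_def same_def by metis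
  qed
next
  assume R: ?R
  show ?L
    unfolding well_nested_def
  proof (intro allI impI)
    fix i j assume "matched U w i j"
    then obtain v c u r x where w: "w = v @ c # u @ r # x" "i = length v" "j = length v + length u + 1"
      and "c \<in> calls U" "r \<in> rets U" "well_matched U u"
      unfolding matched_iff by blast
    with R have "same c r" by blast
    moreover have "w ! i = c" "w ! j = r" using w by (auto simp: nth_append)
    ultimately show "\<exists>k<n. w ! i \<in> K k \<and> w ! j \<in> K k" by (simp add: same_def)
  qed
qed

lemma nest_imp_well_nested:
  assumes "nest [] w \<noteq> None"
  shows "well_nested n Sig w"
  unfolding well_nested_iff
proof (intro allI impI)
  fix v c u r x
  assume w: "w = v @ c # u @ r # x" and c: "c \<in> calls U" and r: "r \<in> rets U"
    and u: "well_matched U u"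
  obtain s where s: "nest [] v = Some s"
    using assms w by (cases "nest [] v") (auto simp: nest_append)
  then obtain t where t: "nest (c # s) u = Some t"
    using assms w c by (cases "nest (c # s) u") (auto simp: nest_append)
  with well_matched_nest_eq[OF u] have "t = c # s" by blast
  with s t show "same c r"
    using assms w c r U_disj by (auto simp: nest_append split: if_splits)
qed

text \<open>Well-nestedness constrains matched pairs only. The projections exclude the rest: a
  return met on an empty stack would be pending in its own projection too, and so would a call left
  over at the end.\<close>

lemma well_nested_imp_nest:
  assumes w: "set w \<subseteq> letters U" and wn: "well_nested n Sig w"
    and wm: "\<And>i. i < n \<Longrightarrow> well_matched (Sig i) (proj i w)"
  shows "nest [] w = Some []"
proof -
  have "nest [] v \<noteq> None" if "w = v @ x" for v x
    using that
  proof (induction v arbitrary: x rule: rev_induct)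
    case (snoc a v)
    then obtain s where s: "nest [] v = Some s" by fastforce
    show ?case
    proof (cases "a \<in> rets U")
      case True
      then obtain i where i: "i < n" "a \<in> K i" using w snoc.prems by (auto simp: union_sets(4))
      have "nest [] (proj i v) = Some (proj i s)" using nest_proj[OF i(1) s] by simp
      moreover have "nest [] (proj i w) = Some []"
        using nest_well_matched[OF i(1) wm[OF i(1)]] .
      ultimately have "s \<noteq> []"
        using snoc.prems i True U_disj by (auto simp: nest_append)
      then obtain c t where t: "s = c # t" by (cases s) auto
      then obtain v' u where v': "v = v' @ c # u" "well_matched U u" "nest [] v' = Some t"
        using nest_decompose[of v c t] s w snoc.prems by auto
      moreover have "c \<in> calls U" using nest_set[OF s] t by auto
      ultimately have "same c a"
        using wn True snoc.prems unfolding well_nested_iff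
        by (metis append.assoc append_Cons append_Nil)
      then show ?thesis using s t True U_disj by (simp add: nest_append)
    next
      case False
      then show ?thesis using s by (simp add: nest_append)
    qed
  qed simp
  then obtain s where s: "nest [] w = Some s" by fastforce
  have "proj i s = []" if "i < n" for i
    using nest_proj[OF that s] nest_well_matched[OF that wm[OF that], of "[]"] by simp
  then have "\<forall>i<n. \<forall>c\<in>set s. c \<notin> K i" by (simp add: filter_empty_conv)
  moreover have "set s \<subseteq> letters U" using nest_set[OF s] by (auto simp: letters_def)
  ultimately have "s = []" by (cases s) (auto simp: union_sets(4))
  with s show ?thesis by simp
qed

text \<open>At every moment the component of the innermost pending call may proceed, and any
  component may if no call is pending; hence no partial schedule is stuck.\<close>
lemma nest_completion:
  assumes "set s \<subseteq> letters U" "\<And>i. i < n \<Longrightarrow> set (x i) \<subseteq> K i"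
    "\<And>i. i < n \<Longrightarrow> nest (proj i s) (x i) = Some []"
  shows "\<exists>w. set w \<subseteq> letters U \<and> nest s w = Some [] \<and> (\<forall>i<n. proj i w = x i)"
  using assms
proof (induction "\<Sum>i<n. length (x i)" arbitrary: s x rule: less_induct)
  case less
  show ?case
  proof (cases "s = [] \<and> (\<forall>i<n. x i = [])")
    case True
    then show ?thesis by (intro exI[of _ "[]"]) auto
  next
    case False
    \<comment> \<open>The component to run next: that of the top call, which still owes a return, or
      any unfinished one when no call is pending.\<close>
    have "\<exists>k<n. x k \<noteq> [] \<and> (s \<noteq> [] \<longrightarrow> hd s \<in> K k)"
    proof (cases s)
      case Nil
      then show ?thesis using False by auto
    next
      case (Cons c t)
      then obtain k where k: "k < n" "c \<in> K k" using less.prems(1) by (auto simp: union_sets(4))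
      then have "x k \<noteq> []" using less.prems(3)[OF k(1)] Cons by auto
      with k Cons show ?thesis by auto
    qed
    then obtain k y r where k: "k < n" "x k = y # r" "s \<noteq> [] \<longrightarrow> hd s \<in> K k"
      by (metis neq_Nil_conv)
    have y: "y \<in> K k" "y \<in> letters U" using less.prems(2)[OF k(1)] k by (auto simp: union_sets(4))
    \<comment> \<open>If \<open>y\<close> is a return, component \<open>k\<close> alone could not
      read it on an empty stack, so \<open>s\<close> is nonempty and its top belongs to
      \<open>k\<close>.\<close>
    have "nest s [y] \<noteq> None"
      using less.prems(3)[OF k(1)] k y same_iff[OF k(1)] U_disj(1)[of y] by (cases s) auto
    then obtain s1 where s1: "nest s [y] = Some s1" by blast
    let ?x = "x(k := r)"
    have len: "(\<Sum>i<n. length (?x i)) < (\<Sum>i<n. length (x i))"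
      using k by (intro sum_strict_mono_ex1) auto
    have set: "set s1 \<subseteq> letters U"
      using nest_set[OF s1] less.prems(1) by (auto simp: letters_def)
    have sub: "set (?x i) \<subseteq> K i" if "i < n" for i
      using less.prems(2)[OF that] k by auto
    have nest: "nest (proj i s1) (?x i) = Some []" if i: "i < n" for i
    proof (cases "i = k")
      case True
      then show ?thesis
        using less.prems(3)[OF i] nest_proj[OF i s1] k y nest_Cons[of "proj k s" y r] by simp
    next
      case False
      then have "y \<notin> K i" using K_unique i k y by blast
      then show ?thesis using less.prems(3)[OF i] nest_proj[OF i s1] False by simp
    qed
    obtain w where w: "set w \<subseteq> letters U" "nest s1 w = Some []" "\<forall>i<n. proj i w = ?x i"
      using less.hyps[OF len set sub nest] by blast
    have "nest s (y # w) = Some []" using s1 w by (simp only: nest_Cons[of s y w]) simp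
    moreover have "\<forall>i<n. proj i (y # w) = x i" using w k y K_unique[OF k(1) _ y(1)] by auto
    ultimately show ?thesis using w y by (intro exI[of _ "y # w"]) auto
  qed
qed

section \<open>Trace equivalence and projections\<close>

lemma trace_equiv_proj:
  assumes "(u, w) \<in> trace_equiv (indep n Sig)"
  shows "\<forall>i<n. proj i u = proj i w"
  using assms unfolding trace_equiv_def
proof (induction rule: rtrancl_induct)
  case (step v w)
  then obtain x a b y where "v = x @ a # b # y" "w = x @ b # a # y" "(a, b) \<in> indep n Sig"
    by blast
  moreover then have "\<not> (a \<in> K i \<and> b \<in> K i)" if "i < n" for i
    using that K_unique unfolding indep_def by blast
  ultimately show ?case using step.IH by auto
qed simp

lemma trace_equiv_Cons:
  assumes "(u, w) \<in> trace_equiv I"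
  shows "(a # u, a # w) \<in> trace_equiv I"
  using assms unfolding trace_equiv_def
proof (induction rule: rtrancl_induct)
  case (step v w)
  then obtain x b c y where "v = x @ b # c # y" "w = x @ c # b # y" "(b, c) \<in> I" by blast
  then have "(a # v, a # w) \<in> {(u @ a # b # v, u @ b # a # v) | u a b v. (a, b) \<in> I}"
    by (auto intro!: exI[of _ "a # x"])
  with step.IH show ?case by (rule rtrancl_into_rtrancl)
qed simp

lemma trace_equiv_trans:
  "(u, v) \<in> trace_equiv I \<Longrightarrow> (v, w) \<in> trace_equiv I \<Longrightarrow> (u, w) \<in> trace_equiv I"
  unfolding trace_equiv_def by (rule rtrancl_trans)

lemma trace_equiv_move:
  assumes "i < n" "b \<in> K i" "set u \<subseteq> letters U" "set u \<inter> K i = {}"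
  shows "(u @ b # v, b # u @ v) \<in> trace_equiv (indep n Sig)"
  using assms(3,4)
proof (induction u)
  case Nil
  then show ?case by (simp add: trace_equiv_def)
next
  case (Cons a u)
  then obtain j where "j < n" "a \<in> K j" "j \<noteq> i" by (auto simp: union_sets(4))
  then have "(a, b) \<in> indep n Sig" using assms(1,2) unfolding indep_def by blast
  then have "([] @ a # b # (u @ v), [] @ b # a # (u @ v)) \<in> trace_equiv (indep n Sig)"
    unfolding trace_equiv_def by blast
  moreover have "(a # (u @ b # v), a # (b # u @ v)) \<in> trace_equiv (indep n Sig)"
    using Cons by (intro trace_equiv_Cons) auto
  ultimately show ?case using trace_equiv_trans by fastforce
qed

text \<open>Converse of \<open>trace_equiv_proj\<close>. The first letter of \<open>w\<close> is
  also the first of its component in \<open>u\<close>, hence preceded there only by independent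
  letters, and can be moved to the front.\<close>

lemma proj_imp_trace_equiv:
  assumes "set u \<subseteq> letters U" "set w \<subseteq> letters U" "\<And>i. i < n \<Longrightarrow> proj i u = proj i w"
  shows "(u, w) \<in> trace_equiv (indep n Sig)"
  using assms
proof (induction w arbitrary: u)
  case Nil
  then have "\<forall>i<n. \<forall>a\<in>set u. a \<notin> K i" by (simp add: filter_empty_conv)
  with Nil.prems(1) have "u = []" by (cases u) (auto simp: union_sets(4))
  then show ?case by (simp add: trace_equiv_def)
next
  case (Cons b w)
  then obtain j where j: "j < n" "b \<in> K j" by (auto simp: union_sets(4))
  then have "proj j u = b # proj j w" using Cons.prems(3)[OF j(1)] by simp
  then obtain u1 u2 where u: "u = u1 @ b # u2" "\<forall>a\<in>set u1. a \<notin> K j"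
    by (auto dest: filter_eq_ConsD)
  have "proj i (u1 @ u2) = proj i w" if i: "i < n" for i
  proof (cases "i = j")
    case True
    have "proj j u1 = []" using u(2) by (simp add: filter_empty_conv)
    then show ?thesis using Cons.prems(3)[OF i] u j True by simp
  next
    case False
    then have "b \<notin> K i" using K_unique i j by blast
    then show ?thesis using Cons.prems(3)[OF i] u by simp
  qed
  then have "(u1 @ u2, w) \<in> trace_equiv (indep n Sig)" using Cons.IH Cons.prems u by auto
  then have "(b # u1 @ u2, b # w) \<in> trace_equiv (indep n Sig)" by (rule trace_equiv_Cons)
  moreover have "(u, b # u1 @ u2) \<in> trace_equiv (indep n Sig)"
    unfolding u(1) using trace_equiv_move[OF j] u Cons.prems(1) by auto
  ultimately show ?case using trace_equiv_trans by blast
qed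

text \<open>Stack symbols are pairs of a pending call and, for calls of component \<open>i\<close>,
  the symbol pushed by the automaton of that component.\<close>
definition component_vpa :: "nat \<Rightarrow> ('s, 'g, 'a) vpa \<Rightarrow> ('s, 'a \<times> 'g option, 'a) vpa" where
  "component_vpa i A = \<lparr>states = states A, stk = calls U \<times> insert None (Some ` stk A),
     init = init A, final = final A,
     dcall = {(q, a, q', (a, Some g)) | q a q' g. (q, a, q', g) \<in> dcall A} \<union>
       {(q, a, q, (a, None)) | q a. q \<in> states A \<and> a \<in> calls U - K i},
     dret = {(q, a, Some (c, Some g), q') | q a c g q'.
         (q, a, Some g, q') \<in> dret A \<and> c \<in> calls U \<and> same c a} \<union>
       {(q, a, Some (c, None), q) | q a c.
         q \<in> states A \<and> a \<in> rets U - K i \<and> c \<in> calls U \<and> same c a},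
     dint = dint A \<union> {(q, a, q) | q a. q \<in> states A \<and> a \<in> ints U - K i}\<rparr>"

lemma component_vpa_wf:
  assumes "i < n" "vpa_wf (Sig i) A"
  shows "vpa_wf U (component_vpa i A)"
proof -
  have "finite (calls U)" using vp_alph_U by (auto simp: vp_alph_def letters_def)
  moreover have "calls (Sig i) \<subseteq> calls U" "rets (Sig i) \<subseteq> rets U" "ints (Sig i) \<subseteq> ints U"
    using assms(1) by (auto simp: union_sets)
  ultimately show ?thesis
    using assms(2) unfolding vpa_wf_def component_vpa_def by auto
qed

text \<open>Recovers the stack of the component automaton from that of
  \<open>component_vpa\<close>.\<close>

abbreviation syms :: "('a \<times> 'g option) list \<Rightarrow> 'g list" where
  "syms \<equiv> List.map_filter snd"

lemma syms_simps [simp]: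
  "syms [] = []" "syms ((c, None) # s) = syms s" "syms ((c, Some g) # s) = g # syms s"
  by (auto simp: List.map_filter_simps)

lemma vstep_component_vpa:
  assumes i: "i < n" and A: "vpa_wf (Sig i) A"
    and step: "vstep (component_vpa i A) (q, st) a (q', st')"
  shows "nest (map fst st) [a] = Some (map fst st')"
    and "vrun A (q, syms st) (proj i [a]) (q', syms st')"
proof -
  have wf: "vpa_wf U (component_vpa i A)" using component_vpa_wf[OF i A] .
  have sub: "calls (Sig i) \<subseteq> K i" "rets (Sig i) \<subseteq> K i" "ints (Sig i) \<subseteq> K i"
    by (auto simp: letters_def)
  have A': "(q, a, q', g) \<in> dcall A \<Longrightarrow> a \<in> K i" "(q, a, x, q') \<in> dret A \<Longrightarrow> a \<in> K i"
     "(q, a, q') \<in> dint A \<Longrightarrow> a \<in> K i" for g x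
    using A sub unfolding vpa_wf_def by blast+
  have "a \<in> letters U" using vstep_letter[OF wf step] .
  then have "nest (map fst st) [a] = Some (map fst st') \<and>
    vrun A (q, syms st) (proj i [a]) (q', syms st')"
  proof (cases rule: letters_cases)
    case 1
    then show ?thesis
      using step A'(1) unfolding vstep_call[OF wf vp_alph_U 1]
      by (auto simp: component_vpa_def vstep_def)
  next
    case 2
    then have "a \<notin> calls U" using U_disj by blast
    \<comment> \<open>\<open>component_vpa\<close> has no transition on the bottom symbol, so a
      return forces a nonempty stack.\<close>
    obtain c x where cx: "st = (c, x) # st'" "(q, a, Some (c, x), q') \<in> dret (component_vpa i A)"
      using step unfolding vstep_ret[OF wf vp_alph_U 2] by (auto simp: component_vpa_def)
    with 2 \<open>a \<notin> calls U\<close> show ?thesis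
      using A'(2) by (auto simp: component_vpa_def vstep_def)
  next
    case 3
    then have "a \<notin> calls U" "a \<notin> rets U" using U_disj by blast+
    then show ?thesis
      using step A'(3) unfolding vstep_int[OF wf vp_alph_U 3]
      by (auto simp: component_vpa_def vstep_def)
  qed
  then show "nest (map fst st) [a] = Some (map fst st')"
    "vrun A (q, syms st) (proj i [a]) (q', syms st')" by auto
qed

lemma vrun_component_vpa:
  assumes i: "i < n" and A: "vpa_wf (Sig i) A"
  shows "vrun (component_vpa i A) (q, st) w (q', st') \<Longrightarrow>
    nest (map fst st) w = Some (map fst st') \<and> vrun A (q, syms st) (proj i w) (q', syms st')"
proof (induction w arbitrary: q st)
  case (Cons a w)
  then obtain p t where 1: "vstep (component_vpa i A) (q, st) a (p, t)"
    and 2: "vrun (component_vpa i A) (p, t) w (q', st')" by auto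
  note step = vstep_component_vpa[OF i A 1]
  have "proj i (a # w) = proj i [a] @ proj i w" by simp
  then have "vrun A (q, syms st) (proj i (a # w)) (q', syms st')"
    using step(2) Cons.IH[OF 2] by (auto simp only: vrun_append)
  with step(1) Cons.IH[OF 2] show ?case unfolding nest_Cons[of _ a w] by simp
qed auto

text \<open>Serves to build runs: \<open>same\<close> decides whether the popped call lies in
  component \<open>i\<close>, and the tag then guarantees that the matching kind of return
  transition exists.\<close>

definition tagged :: "nat \<Rightarrow> ('a \<times> 'g option) list \<Rightarrow> bool" where
  "tagged i st \<longleftrightarrow> (\<forall>(c, x) \<in> set st. c \<in> calls U \<and> (c \<in> K i \<longleftrightarrow> x \<noteq> None))"

lemma component_vpa_step_exists:
  assumes i: "i < n" and A: "vpa_wf (Sig i) A" and q: "q \<in> states A" and a: "a \<in> letters U"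
    and st: "tagged i st" and nest: "nest (map fst st) [a] \<noteq> None"
    and run: "vrun A (q, syms st) (proj i [a]) (q', s')"
  shows "\<exists>st'. vstep (component_vpa i A) (q, st) a (q', st') \<and> syms st' = s' \<and> tagged i st'"
proof (cases "a \<in> K i")
  case True
  note S = alph[OF i] and sets = component_sets[OF i True]
  have step: "vstep A (q, syms st) a (q', s')" using run True by simp
  from True show ?thesis
  proof (cases rule: letters_cases)
    case 1
    then obtain g where g: "(q, a, q', g) \<in> dcall A" "s' = g # syms st"
      using step vstep_call[OF A S 1] by auto
    then show ?thesis using st True 1 sets
      by (intro exI[of _ "(a, Some g) # st"]) (auto simp: vstep_def component_vpa_def tagged_def)
  next
    case 2
    then have "a \<in> rets U" "a \<notin> calls U" using sets U_disj by auto
    then obtain c x t where t: "st = (c, x) # t" "same c a"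
      using nest by (auto split: list.splits if_splits)
    then have "c \<in> K i" using same_iff[OF i] True by blast
    then obtain g where x: "x = Some g" using st t by (auto simp: tagged_def)
    then have "(q, a, Some g, q') \<in> dret A" "s' = syms t"
      using step vstep_ret[OF A S 2] t by auto
    then show ?thesis using st t x
      by (intro exI[of _ t]) (auto simp: vstep_def component_vpa_def tagged_def)
  next
    case 3
    then have "(q, a, q') \<in> dint A" "s' = syms st"
      using step vstep_int[OF A S 3] by auto
    then show ?thesis using st
      by (intro exI[of _ st]) (auto simp: vstep_def component_vpa_def)
  qed
next
  case False
  then have run: "q' = q" "s' = syms st" using run by auto
  from a show ?thesis
  proof (cases rule: letters_cases)
    case 1
    then show ?thesis using st q False run
      by (intro exI[of _ "(a, None) # st"]) (auto simp: vstep_def component_vpa_def tagged_def)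
  next
    case 2
    then have "a \<notin> calls U" using U_disj by auto
    then obtain c x t where t: "st = (c, x) # t" "same c a"
      using nest 2 by (auto split: list.splits if_splits)
    then have "c \<notin> K i" using same_iff[OF i] False by blast
    then have "x = None" using st t by (auto simp: tagged_def)
    then show ?thesis using st t run q 2 False
      by (intro exI[of _ t]) (auto simp: vstep_def component_vpa_def tagged_def)
  next
    case 3
    then show ?thesis using st q False run
      by (intro exI[of _ st]) (auto simp: vstep_def component_vpa_def)
  qed
qed

lemma component_vpa_run_exists:
  assumes i: "i < n" and A: "vpa_wf (Sig i) A"
  shows "q \<in> states A \<Longrightarrow> set w \<subseteq> letters U \<Longrightarrow> tagged i st \<Longrightarrow>
    nest (map fst st) w \<noteq> None \<Longrightarrow> vrun A (q, syms st) (proj i w) (q', s') \<Longrightarrow>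
    \<exists>st'. vrun (component_vpa i A) (q, st) w (q', st')"
proof (induction w arbitrary: q st)
  case (Cons a w)
  have "proj i (a # w) = proj i [a] @ proj i w" by simp
  obtain p s where p: "vrun A (q, syms st) (proj i [a]) (p, s)"
    "vrun A (p, s) (proj i w) (q', s')"
    using Cons.prems(5) unfolding \<open>proj i (a # w) = _\<close> vrun_append by force
  have "nest (map fst st) [a] \<noteq> None"
    using Cons.prems(4) unfolding nest_Cons[of _ a w] by (metis Option.bind.bind_lzero)
  then obtain t where t: "vstep (component_vpa i A) (q, st) a (p, t)" "syms t = s" "tagged i t"
    using component_vpa_step_exists[OF i A Cons.prems(1) _ Cons.prems(3) _ p(1)] Cons.prems(2)
    by auto
  have "nest (map fst t) w \<noteq> None"
    using Cons.prems(4) vstep_component_vpa(1)[OF i A t(1)] unfolding nest_Cons[of _ a w] by simp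
  moreover have "p \<in> states A"
    using vstep_wf(1)[OF component_vpa_wf[OF i A] t(1)] by (simp add: component_vpa_def)
  ultimately show ?case using Cons.IH[of p t] Cons.prems t p by auto
qed auto

text \<open>The condition is \<open>nest [] w \<noteq> None\<close> and not an empty stack at the
  end, since acceptance by final state does not inspect the stack.\<close>

lemma vp_language_component:
  assumes i: "i < n" and L: "vp_language (Sig i) L"
  shows "vp_language U {w \<in> lists (letters U). nest [] w \<noteq> None \<and> proj i w \<in> L}"
proof -
  obtain A :: "(nat, nat, 'a) vpa" where A: "vpa_wf (Sig i) A" and L: "vlang (Sig i) A = L"
    using L unfolding vp_language_def by blast
  have "w \<in> vlang U (component_vpa i A) \<longleftrightarrow> nest [] w \<noteq> None \<and> proj i w \<in> L"
    if w: "w \<in> lists (letters U)" for w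
  proof -
    have "proj i w \<in> lists (K i)" by auto
    moreover have "q \<in> states A" if "q \<in> init A" for q using A that by (auto simp: vpa_wf_def)
    moreover have "(\<exists>s. vrun (component_vpa i A) (q, []) w (q', s)) \<longleftrightarrow>
        nest [] w \<noteq> None \<and> (\<exists>s. vrun A (q, []) (proj i w) (q', s))" if "q \<in> states A" for q q'
      using vrun_component_vpa[OF i A, of q "[]" w q']
        component_vpa_run_exists[OF i A that, of w "[]" q'] w
      by (auto simp: tagged_def)
    ultimately show ?thesis
      using w unfolding L[symmetric] vlang_def by (auto simp: component_vpa_def)
  qed
  moreover have "vlang U (component_vpa i A) \<subseteq> lists (letters U)"
    unfolding vlang_def by blast
  ultimately have "vlang U (component_vpa i A) =
      {w \<in> lists (letters U). nest [] w \<noteq> None \<and> proj i w \<in> L}"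
    by blast
  with vp_languageI[OF component_vpa_wf[OF i A]] show ?thesis by simp
qed

section \<open>Minimal words of the nested shuffle\<close>

context
  fixes P :: "nat \<Rightarrow> 'a list set"
  assumes wm: "\<forall>i<n. \<forall>w\<in>P i. well_matched (Sig i) w"
begin

lemma in_nested_shuffle_iff:
  "w \<in> nested_shuffle n Sig P \<longleftrightarrow>
     w \<in> lists (letters U) \<and> nest [] w = Some [] \<and> (\<forall>i<n. proj i w \<in> P i)"
proof -
  have "well_nested n Sig w \<longleftrightarrow> nest [] w = Some []"
    if "w \<in> lists (letters U)" "\<forall>i<n. proj i w \<in> P i"
  proof -
    have "set w \<subseteq> letters U" using that(1) by auto
    then show ?thesis
      using nest_imp_well_nested[of w] well_nested_imp_nest[of w] that(2) wm by auto
  qed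
  then show ?thesis unfolding nested_shuffle_def shuffle_def by auto
qed

lemma nested_shuffle_eq:
  "nested_shuffle n Sig P = lists (letters U) \<inter>
     (\<Inter>i\<in>{..<n}. {w \<in> lists (letters U). nest [] w \<noteq> None \<and> proj i w \<in> P i})"
proof -
  have "nest [] w = Some []" if "w \<in> lists (letters U)" "\<forall>i<n. nest [] w \<noteq> None \<and> proj i w \<in> P i" for w
  \<comment> \<open>Without components the nesting condition is vacuous, but the empty word is the
    only word.\<close>
  proof (cases "n = 0")
    case True
    then have "letters U = {}" unfolding union_sets(4) by simp
    then have "w = []" using that(1) by (cases w) auto
    then show ?thesis by simp
  next
    case False
    then have "nest [] w \<noteq> None" using that(2) by blast
    then show ?thesis
      using that wm by (intro well_nested_imp_nest nest_imp_well_nested) auto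
  qed
  then show ?thesis unfolding set_eq_iff in_nested_shuffle_iff by auto
qed

text \<open>An overtaken \<open>a\<close> can be scheduled at the earlier position, and
  \<open>nest_completion\<close> supplies the rest of a smaller equivalent word. Conversely, the
  first difference from a smaller equivalent word exhibits an overtaken letter.\<close>

lemma red_nested_shuffle_eq:
  assumes prec: "contextual_order (letters U) prec"
  shows "red (indep n Sig) prec (nested_shuffle n Sig P) = nested_shuffle n Sig P \<inter>
     {w. \<forall>i<n. \<forall>a\<in>K i. overtaking_free U (K i) prec a w}"
    (is "?red = ?L \<inter> ?F")
proof (intro set_eqI iffI)
  fix w assume w: "w \<in> ?red"
  then have wL: "w \<in> ?L" and min: "\<And>u. u \<in> ?L \<Longrightarrow> (u, w) \<in> trace_equiv (indep n Sig) \<Longrightarrow>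
      ctx_le prec u w \<Longrightarrow> u = w"
    unfolding red_def by auto
  have wU: "set w \<subseteq> letters U" and wn: "nest [] w = Some []" and wP: "\<forall>i<n. proj i w \<in> P i"
    using wL in_nested_shuffle_iff by auto
  have "overtaking_free U (K i) prec a w" if i: "i < n" and a: "a \<in> K i" for i a
  proof (rule ccontr)
    assume "\<not> overtaking_free U (K i) prec a w"
    then obtain v b x y where 1: "w = v @ b # x @ a # y" "set (b # x) \<inter> K i = {}"
      "(a, b) \<in> prec v" "a \<in> rets U \<longrightarrow> top_in (K i) (pending U v)"
      unfolding overtaking_free_def overtaken_def by auto
    have aU: "a \<in> letters U" using i a by (auto simp: union_sets(4))
    obtain s where s: "nest [] v = Some s"
      using wn 1 by (cases "nest [] v") (auto simp: nest_append)
    have "nest [] (v @ [a]) \<noteq> None"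
      using s 1(4) nest_pending[OF s] same_iff[OF i a] U_disj(1)[of a]
      by (cases s) (auto simp: nest_append top_in_def)
    then obtain t where t: "nest [] (v @ [a]) = Some t" by blast
    \<comment> \<open>What each component still has to read after \<open>v @ [a]\<close>: component
      \<open>i\<close> has used up \<open>a\<close> and has no letter in
      \<open>b # x\<close>.\<close>
    let ?x = "\<lambda>j. if j = i then proj i y else proj j (b # x @ y)"
    have pw: "proj j w = proj j (v @ [a]) @ ?x j" if j: "j < n" for j
    proof (cases "j = i")
      case True
      have "proj i (b # x) = []" using 1(2) by (simp add: filter_empty_conv) blast
      then show ?thesis using 1(1) a True by (auto split: if_splits)
    next
      case False
      then have "a \<notin> K j" using K_unique i j a by blast
      then show ?thesis using 1(1) False by auto
    qed
    have "\<exists>z. set z \<subseteq> letters U \<and> nest t z = Some [] \<and> (\<forall>j<n. proj j z = ?x j)"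
    proof (rule nest_completion)
      show "set t \<subseteq> letters U" using nest_set[OF t] by (auto simp: letters_def)
      show "set (?x j) \<subseteq> K j" if "j < n" for j by auto
      \<comment> \<open>Component \<open>j\<close>, reading its part of \<open>w\<close>, has the
        stack \<open>proj j t\<close> after its part of \<open>v @ [a]\<close>, so its remainder
        empties that stack.\<close>
      show "nest (proj j t) (?x j) = Some []" if j: "j < n" for j
        using nest_proj[OF j wn] nest_proj[OF j t] unfolding pw[OF j] nest_append by simp
    qed
    then obtain z where z: "set z \<subseteq> letters U" "nest t z = Some []" "\<forall>j<n. proj j z = ?x j"
      by blast
    let ?u = "v @ a # z"
    have pu: "proj j ?u = proj j w" if j: "j < n" for j
      using z(3) j unfolding pw[OF j] by simp
    have uU: "set ?u \<subseteq> letters U" using wU z(1) aU 1(1) by auto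
    have "nest [] ?u = Some []" using t z(2) nest_append[of "[]" "v @ [a]" z] by simp
    then have "?u \<in> ?L" using uU pu wP in_nested_shuffle_iff by auto
    moreover have "(?u, w) \<in> trace_equiv (indep n Sig)"
      using proj_imp_trace_equiv[OF uU wU pu] .
    moreover have "ctx_le prec ?u w" unfolding ctx_le_def using 1 by blast
    ultimately have "?u = w" using min by blast
    with 1 a show False by auto
  qed
  with wL show "w \<in> ?L \<inter> ?F" by blast
next
  fix w assume w: "w \<in> ?L \<inter> ?F"
  have "u = w" if uL: "u \<in> ?L" and eq: "(u, w) \<in> trace_equiv (indep n Sig)"
    and le: "ctx_le prec u w" for u
  proof (rule ccontr)
    assume ne: "u \<noteq> w"
    have proj: "proj i u = proj i w" if "i < n" for i
      using trace_equiv_proj[OF eq] that by blast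
    show False
      using le unfolding ctx_le_def
    proof (elim disjE exE conjE)
      assume "prefix u w"
      then obtain x where x: "w = u @ x" by (auto simp: prefix_def)
      \<comment> \<open>Equal projections leave no letter for the extension
        \<open>x\<close>.\<close>
      then have "\<forall>i<n. \<forall>a\<in>set x. a \<notin> K i" using proj by (simp add: filter_empty_conv)
      moreover have "set x \<subseteq> letters U" using w x in_nested_shuffle_iff by auto
      ultimately have "x = []" by (cases x) (auto simp: union_sets(4))
      with x ne show False by simp
    next
      fix v a b x y
      assume 1: "u = v @ a # x" "w = v @ b # y" "(a, b) \<in> prec v"
      have "set u \<subseteq> letters U" "nest [] u = Some []" using uL in_nested_shuffle_iff by auto
      then have vU: "v \<in> lists (letters U)" and "a \<in> letters U" and un: "nest [] u = Some []"
        using 1(1) by auto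
      then obtain i where i: "i < n" "a \<in> K i" by (auto simp: union_sets(4))
      \<comment> \<open>By irreflexivity. It makes \<open>b\<close> foreign to component
        \<open>i\<close>, whose next letter after \<open>v\<close> is \<open>a\<close> in both
        words.\<close>
      have "a \<noteq> b" using prec vU 1(3)
        unfolding contextual_order_def strict_linear_order_on_def irrefl_def by blast
      have p: "a # proj i x = proj i (b # y)" using proj[OF i(1)] i 1 by simp
      then have b: "b \<notin> K i" using \<open>a \<noteq> b\<close> by auto
      with p have "proj i y = a # proj i x" by simp
      then obtain y1 y2 where y: "y = y1 @ a # y2" "\<forall>c\<in>set y1. c \<notin> K i"
        by (auto dest: filter_eq_ConsD)
      obtain s where s: "nest [] v = Some s"
        using un 1(1) by (cases "nest [] v") (auto simp: nest_append)
      \<comment> \<open>\<open>u\<close> is nested and reads \<open>a\<close> right after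
        \<open>v\<close>, so a return \<open>a\<close> finds a call of its own component on
        top.\<close>
      have "a \<in> rets U \<longrightarrow> top_in (K i) (pending U v)"
        using un 1(1) s nest_pending[OF s] same_iff[OF i] U_disj(1)[of a]
        by (auto simp: nest_append top_in_def split: list.splits if_splits)
      then have "overtaken U (K i) prec a (v @ b # y1)"
        unfolding overtaken_def using b y(2) 1(3) by fastforce
      moreover have "w = (v @ b # y1) @ a # y2" using 1(2) y(1) by simp
      ultimately have "\<not> overtaking_free U (K i) prec a w"
        unfolding overtaking_free_def by blast
      with w i show False by blast
    qed
  qed
  with w show "w \<in> ?red" unfolding red_def by blast
qed

end

end

theorem theorem4p4:
  fixes n :: nat and Sig :: "nat \<Rightarrow> 'a vpalph" and P :: "nat \<Rightarrow> 'a list set"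
    and prec :: "'a list \<Rightarrow> ('a \<times> 'a) set"
  assumes alph: "\<forall>i<n. vp_alph (Sig i)"
    and disj: "\<forall>i<n. \<forall>j<n. i \<noteq> j \<longrightarrow> letters (Sig i) \<inter> letters (Sig j) = {}"
    and ord: "vp_contextual_order (union_alph n Sig) prec"
    and vpl: "\<forall>i<n. vp_language (Sig i) (P i)"
    and wm: "\<forall>i<n. \<forall>w\<in>P i. well_matched (Sig i) w"
  shows "vp_language (union_alph n Sig) (red (indep n Sig) prec (nested_shuffle n Sig P))"
proof -
  interpret vp_family n Sig using alph disj by unfold_locales auto
  \<comment> \<open>Each letter is paired with its component; finiteness of the alphabets makes the
    family of automata to intersect finite.\<close>
  let ?I = "SIGMA i:{..<n}. K i"
  let ?F = "\<lambda>(i, a). {w \<in> lists (letters U). overtaking_free U (K i) prec a w}"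
  have "finite ?I" using alph by (auto simp: vp_alph_def)
  then have F: "vp_language U (lists (letters U) \<inter> (\<Inter>p\<in>?I. ?F p))"
    using vp_language_overtaking_free[OF vp_alph_U ord] by (intro vp_language_INT vp_alph_U) auto
  have L: "vp_language U (nested_shuffle n Sig P)"
    unfolding nested_shuffle_eq[OF wm]
    using vpl by (intro vp_language_INT vp_alph_U vp_language_component) auto
  have "contextual_order (letters U) prec" using ord by (simp add: vp_contextual_order_def)
  then have "red (indep n Sig) prec (nested_shuffle n Sig P) =
      nested_shuffle n Sig P \<inter> (lists (letters U) \<inter> (\<Inter>p\<in>?I. ?F p))"
    using red_nested_shuffle_eq[OF wm] in_nested_shuffle_iff[OF wm] by auto
  with vp_language_Int[OF vp_alph_U L F] show ?thesis by simp
qed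

end
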